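(* Let $k$ be the number of linkless score sequences of tournaments on 8 vertices, and let $n \geq 8$ be an integer. Then there are at least $(n-7)(k-1)+1$ linkless score sequences of tournaments on $n$ vertices.
   Context: A tournament is a directed graph with exactly one directed edge between each pair of distinct vertices. Its score sequence is the list of outdegrees of its vertices in non-decreasing order. A cycle in a directed graph is consistently oriented if it is a directed cycle. A directed graph $G$ is intrinsically linked as a directed graph if every (tame) embedding of $G$ into $S^3$ contains two vertex-disjoint consistently oriented cycles that form a non-split link. A score sequence $S$ is linkless if every tournament with score sequence $S$ has an embedding into $S^3$ that contains no non-split consistently oriented link (that is, it is not intrinsically linked as a directed graph). *)

theory Defs
  imports
    "HOL-Analysis.Analysis"
    "HOL-Library.Multiset"
    "Graph_Theory.Pair_Digraph"
begin

section \<open>Tournaments and score sequences\<close>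

locale tournament = digraph +
  assumes exactly_one_arc:
    "\<lbrakk>u \<in> verts G; v \<in> verts G; u \<noteq> v\<rbrakk> \<Longrightarrow> (\<exists>!e. e \<in> arcs G \<and> {tail G e, head G e} = {u, v})"

definition score_sequence :: "('a, 'b) pre_digraph \<Rightarrow> nat list" where
  "score_sequence G = sorted_list_of_multiset (image_mset (out_degree G) (mset_set (verts G)))"

section \<open>Tame subsets of the 3-sphere\<close>

abbreviation S3 :: "(real^4) set" where
  "S3 \<equiv> sphere 0 1"

text \<open>
  A proper subset X of the 3-sphere is tame if some homeomorphism of the 3-sphere carries it to a
  polyhedron. The piecewise linear structure used here is the one of the one-point compactification
  of R^3: a self-homeomorphism of the 3-sphere followed by a stereographic projection from a point
  off the image of X is the same thing as a homeomorphism from the complement of a point p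
  onto R^3. The parameter d bounds the dimension of the polyhedron: d = 1 for graphs
  (finite unions of straight segments and points), d = 2 for surfaces.
\<close>

definition tame :: "int \<Rightarrow> (real^4) set \<Rightarrow> bool" where
  "tame d X \<longleftrightarrow> X \<subseteq> S3 \<and>
     (\<exists>p h h' \<P>. p \<in> S3 - X \<and> homeomorphism (S3 - {p}) (UNIV :: (real^3) set) h h' \<and>
        finite \<P> \<and> (\<forall>P\<in>\<P>. polytope P \<and> aff_dim P \<le> d) \<and> h ` X = \<Union>\<P>)"

section \<open>Embeddings of directed graphs\<close>

text \<open>
  An embedding is given by the images f v of the vertices and by a parametrised curve g e for
  every arc e. For an arc that is not a loop, \<^term>\<open>simple_path (g e)\<close> says that g e is injective,
  because its end points f (tail G e) and f (head G e) are distinct.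
\<close>

definition embedded_graph ::
  "('a, 'b) pre_digraph \<Rightarrow> ('a \<Rightarrow> real^4) \<Rightarrow> ('b \<Rightarrow> real \<Rightarrow> real^4) \<Rightarrow> (real^4) set" where
  "embedded_graph G f g = f ` verts G \<union> (\<Union>e\<in>arcs G. path_image (g e))"

definition embedding ::
  "('a, 'b) pre_digraph \<Rightarrow> ('a \<Rightarrow> real^4) \<Rightarrow> ('b \<Rightarrow> real \<Rightarrow> real^4) \<Rightarrow> bool" where
  "embedding G f g \<longleftrightarrow>
     embedded_graph G f g \<subseteq> S3 \<and>
     inj_on f (verts G) \<and>
     (\<forall>e\<in>arcs G. simple_path (g e) \<and> pathstart (g e) = f (tail G e) \<and> pathfinish (g e) = f (head G e)) \<and>
     (\<forall>e\<in>arcs G. \<forall>v\<in>verts G. f v \<in> path_image (g e) \<longrightarrow> v \<in> {tail G e, head G e}) \<and>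
     (\<forall>e\<in>arcs G. \<forall>e'\<in>arcs G. e \<noteq> e' \<longrightarrow>
        path_image (g e) \<inter> path_image (g e') \<subseteq> f ` ({tail G e, head G e} \<inter> {tail G e', head G e'}))"

definition tame_embedding ::
  "('a, 'b) pre_digraph \<Rightarrow> ('a \<Rightarrow> real^4) \<Rightarrow> ('b \<Rightarrow> real \<Rightarrow> real^4) \<Rightarrow> bool" where
  "tame_embedding G f g \<longleftrightarrow> embedding G f g \<and> tame 1 (embedded_graph G f g)"

section \<open>Links\<close>

text \<open>
  A two-component link is split if a tame 2-sphere in its complement has the two components
  on different sides.
\<close>

definition split_link :: "(real^4) set \<Rightarrow> (real^4) set \<Rightarrow> bool" where
  "split_link A B \<longleftrightarrow>
     (\<exists>S. S \<subseteq> S3 - (A \<union> B) \<and> S homeomorphic sphere (0 :: real^3) 1 \<and> tame 2 S \<and>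
        (\<forall>a\<in>A. \<forall>b\<in>B. \<not> connected_component (S3 - S) a b))"

text \<open>
  The cycles of \<^const>\<open>pre_digraph.cycle\<close> are lists of arcs that are traversed from tail to head,
  so they are exactly the consistently oriented ones. The vertices of a cycle are the tails of its arcs.
\<close>

definition has_nonsplit_consistent_link ::
  "('a, 'b) pre_digraph \<Rightarrow> ('b \<Rightarrow> real \<Rightarrow> real^4) \<Rightarrow> bool" where
  "has_nonsplit_consistent_link G g \<longleftrightarrow>
     (\<exists>p q. pre_digraph.cycle G p \<and> pre_digraph.cycle G q \<and>
        tail G ` set p \<inter> tail G ` set q = {} \<and>
        \<not> split_link (\<Union>e\<in>set p. path_image (g e)) (\<Union>e\<in>set q. path_image (g e)))"

definition intrinsically_linked :: "('a, 'b) pre_digraph \<Rightarrow> bool" where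
  "intrinsically_linked G \<longleftrightarrow>
     (\<forall>f g. tame_embedding G f g \<longrightarrow> has_nonsplit_consistent_link G g)"

section \<open>Linkless score sequences\<close>

text \<open>
  Every finite tournament is isomorphic to one whose vertices are natural numbers and whose arcs are
  pairs of vertices, so it suffices to quantify over the latter.
\<close>

definition tournament_score_sequences :: "nat \<Rightarrow> nat list set" where
  "tournament_score_sequences n =
     {score_sequence (with_proj T) | T :: nat pair_pre_digraph. tournament (with_proj T) \<and> card (pverts T) = n}"

definition linkless :: "nat list \<Rightarrow> bool" where
  "linkless S \<longleftrightarrow>
     (\<forall>T :: nat pair_pre_digraph. tournament (with_proj T) \<and> score_sequence (with_proj T) = S \<longrightarrow>
        \<not> intrinsically_linked (with_proj T))"

end

theory Submission
  imports Defs
begin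

text \<open>
  Write $L(n)$ for the set of linkless score sequences on $n$ vertices and $N(n)$ for those of them
  that do not end in $n - 1$, that is, whose tournaments have no source. A source or a sink lies on
  no directed cycle, so it can be added to any good embedding: put the new vertex at a
  generic point and join it to the old vertices by straight segments
  (\<open>not_linked_extend\<close>). Hence appending $n$ maps $L(n)$ into $L(n+1) - N(n+1)$, and
  prepending $0$ while raising all other scores by one maps $N(n)$ into $N(n+1)$. Consequently
  $|L(n+1)| \<ge> |L(n)| + |N(n+1)|$ and $|N(n+1)| \<ge> |N(n)|$, and everything follows from the single
  inequality $|N(9)| \<ge> |L(8)| - 1$.

  For this inequality, the members of $L(8)$ that lie in $N(8)$ are matched with members of $N(9)$ that begin
  with $0$, by adding a sink. The other members of $L(8)$ end in $7$. Removing the source leaves a score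
  sequence on $7$ vertices, and there are only $59$ of these. So $58$ members of $N(9)$ that do not begin
  with $0$ are enough. They are found among the sequences in which, for some $k$ between $3$ and $6$, the $k$ smallest
  scores add up to at most $\binom{k}{2} + 1$: then at most one arc leaves the set of the $k$
  vertices with these scores.

  Every tournament of order nine with such a thin cut is shown to be unlinked. One end $z$ of the
  leaving arc is removed (any vertex on the right side of the cut if no arc leaves), chosen so that the remaining eight vertices fall into a set $P$
  of size $3$ and a set $Q$ of size $5$ such that each directed cycle that avoids $z$ stays inside
  $P$ or inside $Q$. The vertices are placed on the moment curve $t \<mapsto> (t, t^2, t^3)$ and all arcs are drawn
  as chords. Planes meet this curve in the zeros of cubic polynomials, so two vertex sets
  have disjoint convex hulls as soon as a cubic polynomial is positive on one and negative on the other;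
  and two cycles with disjoint hulls are split by the boundary of a polytope. It is therefore enough to
  order the vertices such that the blocks of any two disjoint cycles alternate at most three
  times. The order $Q$, $P$, $z$ does this if $Q$ is arranged so that three particular triples in
  it are not directed triangles, and this is always possible (\<open>five_vertices_arrangement\<close>).
\<close>


section \<open>Tournaments as relations\<close>

text \<open>
  A relational form of \<^const>\<open>tournament\<close>; arcs are pairs, so no separate incidence maps are needed.
\<close>

definition tournament_on :: "'a set \<Rightarrow> 'a rel \<Rightarrow> bool" where
  "tournament_on V E \<longleftrightarrow> finite V \<and> E \<subseteq> V \<times> V \<and> (\<forall>u. (u, u) \<notin> E) \<and>
     (\<forall>u\<in>V. \<forall>v\<in>V. u \<noteq> v \<longrightarrow> ((u, v) \<in> E \<longleftrightarrow> (v, u) \<notin> E))"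

lemma tournament_onD:
  assumes "tournament_on V E"
  shows "finite V" "finite E" "(u, v) \<in> E \<Longrightarrow> u \<in> V" "(u, v) \<in> E \<Longrightarrow> v \<in> V" "(u, u) \<notin> E"
    "(u, v) \<in> E \<Longrightarrow> (v, u) \<notin> E" "u \<in> V \<Longrightarrow> v \<in> V \<Longrightarrow> u \<noteq> v \<Longrightarrow> (v, u) \<notin> E \<Longrightarrow> (u, v) \<in> E"
    "(u, v) \<in> E \<Longrightarrow> u \<noteq> v"
proof -
  have fin: "finite V" and sub: "E \<subseteq> V \<times> V" and irr: "\<And>u. (u, u) \<notin> E"
    and one: "\<And>u v. u \<in> V \<Longrightarrow> v \<in> V \<Longrightarrow> u \<noteq> v \<Longrightarrow> (u, v) \<in> E \<longleftrightarrow> (v, u) \<notin> E"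
    using assms unfolding tournament_on_def by blast+
  show "finite V" by (fact fin)
  show "finite E" by (rule finite_subset[OF sub]) (simp add: fin)
  show uV: "u \<in> V" and vV: "v \<in> V" if "(u, v) \<in> E" using sub that by auto
  show "(u, u) \<notin> E" by (fact irr)
  show "(u, v) \<in> E" if "u \<in> V" "v \<in> V" "u \<noteq> v" "(v, u) \<notin> E"
    using one[of v u] that by blast
  show ne: "u \<noteq> v" if "(u, v) \<in> E" using irr that by blast
  show "(v, u) \<notin> E" if "(u, v) \<in> E"
    using one[OF uV vV ne] that by blast
qed

lemma tournament_iff: "tournament (with_proj T) \<longleftrightarrow> tournament_on (pverts T) (parcs T)"
proof
  assume "tournament (with_proj T)"
  then interpret tournament "with_proj T" .
  have wf: "(u, v) \<in> parcs T \<Longrightarrow> u \<in> pverts T \<and> v \<in> pverts T" for u v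
    using wellformed[of "(u, v)"] by simp
  have "(u, u) \<notin> parcs T" for u
    using no_loops[of "(u, u)"] by auto
  moreover have "(u, v) \<in> parcs T \<longleftrightarrow> (v, u) \<notin> parcs T"
    if uv: "u \<in> pverts T" "v \<in> pverts T" "u \<noteq> v" for u v
  proof -
    have ends: "{fst e, snd e} = {u, v} \<longleftrightarrow> e = (u, v) \<or> e = (v, u)" for e
      by (cases e) (simp add: doubleton_eq_iff)
    have "\<exists>!e. e \<in> parcs T \<and> (e = (u, v) \<or> e = (v, u))"
      using exactly_one_arc[unfolded with_proj_simps, OF uv] by (simp only: ends)
    then show ?thesis
    proof (elim ex1E conjE)
      fix e
      assume e: "e \<in> parcs T" "e = (u, v) \<or> e = (v, u)"
        and uniq: "\<forall>e'. e' \<in> parcs T \<and> (e' = (u, v) \<or> e' = (v, u)) \<longrightarrow> e' = e"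
      have "\<not> ((u, v) \<in> parcs T \<and> (v, u) \<in> parcs T)"
        using uniq[rule_format, of "(u, v)"] uniq[rule_format, of "(v, u)"] uv(3) by force
      then show ?thesis using e by blast
    qed
  qed
  moreover have "parcs T \<subseteq> pverts T \<times> pverts T"
    using wf by (simp add: subset_iff)
  moreover have "finite (pverts T)"
    using finite_verts by simp
  ultimately show "tournament_on (pverts T) (parcs T)"
    unfolding tournament_on_def by (intro conjI ballI allI impI)
next
  assume T: "tournament_on (pverts T) (parcs T)"
  show "tournament (with_proj T)"
  proof
    fix u v
    assume uv: "u \<in> verts (with_proj T)" "v \<in> verts (with_proj T)" "u \<noteq> v"
    have ends: "{fst e, snd e} = {u, v} \<longleftrightarrow> e = (u, v) \<or> e = (v, u)" for e
      by (cases e) (simp add: doubleton_eq_iff)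
    have "(u, v) \<in> parcs T \<longleftrightarrow> (v, u) \<notin> parcs T"
      using T uv unfolding tournament_on_def with_proj_simps by blast
    then show "\<exists>!e. e \<in> arcs (with_proj T) \<and> {tail (with_proj T) e, head (with_proj T) e} = {u, v}"
      unfolding with_proj_simps ends by (cases "(u, v) \<in> parcs T") auto
  next
    show "tail (with_proj T) e \<in> verts (with_proj T)" "head (with_proj T) e \<in> verts (with_proj T)"
      "tail (with_proj T) e \<noteq> head (with_proj T) e" if "e \<in> arcs (with_proj T)" for e
      using tournament_onD(3,4,8)[OF T, of "fst e" "snd e"] that by simp_all
  next
    show "finite (verts (with_proj T))" "finite (arcs (with_proj T))"
      using tournament_onD(1,2)[OF T] by simp_all
  next
    show "e1 = e2" if "arc_to_ends (with_proj T) e1 = arc_to_ends (with_proj T) e2" for e1 e2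
      using that by (simp add: arc_to_ends_def prod_eq_iff)
  qed
qed

section \<open>Directed cycles and strong sets\<close>

text \<open>
  Vertex sets of directed cycles are strongly connected and have at least three elements, and this
  is all that the ordering arguments use of cycles. Working with sets removes the cyclic order from
  these arguments.
\<close>

definition strong :: "'a rel \<Rightarrow> 'a set \<Rightarrow> bool" where
  "strong E C \<longleftrightarrow> 3 \<le> card C \<and> (\<forall>X. X \<noteq> {} \<longrightarrow> X \<subset> C \<longrightarrow> (\<exists>x\<in>X. \<exists>y\<in>C - X. (x, y) \<in> E))"

lemma cycle_with_projD:
  assumes "pre_digraph.cycle (with_proj T) p"
  obtains u where "pcas u p u" "p \<noteq> []" "set p \<subseteq> parcs T"
  using assms unfolding pre_digraph.cycle_def pre_digraph.awalk_def
  by (auto simp: cas_with_proj_eq)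

lemma walk_trapped:
  assumes "pcas u p v" "\<forall>e\<in>set p. fst e \<in> X \<longrightarrow> snd e \<in> X" "u \<in> X"
  shows "v \<in> X \<and> fst ` set p \<subseteq> X"
  using assms
proof (induction p arbitrary: u)
  case (Cons e p)
  have "snd e \<in> X"
    using Cons.prems by simp
  moreover have "pcas (snd e) p v" "fst e = u" using Cons.prems(1) by simp_all
  ultimately have "v \<in> X \<and> fst ` set p \<subseteq> X"
    using Cons.prems(2) by (intro Cons.IH[of "snd e"]) simp_all
  then show ?case using \<open>fst e = u\<close> Cons.prems(3) by simp
qed simp

lemma walk_ends_trapped:
  assumes "pcas u p v" "\<forall>e\<in>set p. fst e \<in> X \<longrightarrow> snd e \<in> X" "fst ` set p \<inter> X \<noteq> {}"
  shows "v \<in> X"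
  using assms
proof (induction p arbitrary: u)
  case (Cons e p)
  show ?case
  proof (cases "fst e \<in> X")
    case True
    then have "u \<in> X" using Cons.prems(1) by simp
    then show ?thesis using walk_trapped[OF Cons.prems(1,2)] by blast
  next
    case False
    then have "fst ` set p \<inter> X \<noteq> {}" using Cons.prems(3) by auto
    moreover have "pcas (snd e) p v" using Cons.prems(1) by simp
    ultimately show ?thesis using Cons.prems(2) by (intro Cons.IH[of "snd e"]) simp_all
  qed
qed simp

text \<open>
  A walk that never leaves $X$ stays in $X$ once it is there; for a closed walk that meets $X$
  this puts every vertex in $X$.
\<close>

lemma closed_walk_leaves:
  assumes "pcas u p u" "X \<noteq> {}" "X \<subset> fst ` set p"
  obtains e where "e \<in> set p" "fst e \<in> X" "snd e \<notin> X"
proof (rule ccontr)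
  assume "\<not> thesis"
  then have closed: "\<forall>e\<in>set p. fst e \<in> X \<longrightarrow> snd e \<in> X" using that by blast
  have "fst ` set p \<inter> X \<noteq> {}" using assms(2,3) by blast
  then have "u \<in> X" using walk_ends_trapped[OF assms(1) closed] by blast
  then have "fst ` set p \<subseteq> X" using walk_trapped[OF assms(1) closed] by blast
  then show False using assms(3) by blast
qed

lemma walk_tails_heads:
  assumes "pcas u p v"
  shows "insert v (fst ` set p) = insert u (snd ` set p)"
  using assms by (induction p arbitrary: u) (auto simp: insert_commute)

lemma closed_walk_heads_eq_tails:
  assumes "pcas u p u" "p \<noteq> []"
  shows "snd ` set p = fst ` set p"
proof -
  have "u \<in> fst ` set p" using assms by (cases p) auto
  moreover have "u \<in> snd ` set p" if "pcas w p u" for w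
    using that assms(2)
  proof (induction p arbitrary: w)
    case (Cons e p)
    then show ?case by (cases p) auto
  qed simp
  ultimately show ?thesis
    using walk_tails_heads[OF assms(1)] assms(1) by (metis insert_absorb)
qed

text \<open>
  The bound on the cardinality excludes cycles of length two: they would need both arcs between
  two vertices.
\<close>

lemma cycle_strong:
  assumes T: "tournament_on (pverts T) (parcs T)" and p: "pre_digraph.cycle (with_proj T) p"
  shows "strong (parcs T) (fst ` set p)" "fst ` set p \<subseteq> pverts T"
proof -
  obtain u where u: "pcas u p u" "p \<noteq> []" "set p \<subseteq> parcs T"
    using cycle_with_projD[OF p] .
  let ?C = "fst ` set p"
  have cut: "\<exists>x\<in>X. \<exists>y\<in>?C - X. (x, y) \<in> parcs T" if X: "X \<noteq> {}" "X \<subset> ?C" for X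
  proof -
    obtain e where e: "e \<in> set p" "fst e \<in> X" "snd e \<notin> X"
      using closed_walk_leaves[OF u(1) X] .
    have "snd e \<in> ?C" using e(1) closed_walk_heads_eq_tails[OF u(1,2)] by blast
    moreover have "(fst e, snd e) \<in> parcs T" using e(1) u(3) by auto
    ultimately show ?thesis using e(2,3) by blast
  qed
  obtain a b where ab: "(a, b) \<in> set p" using u(2) by (cases p) auto
  then have abE: "(a, b) \<in> parcs T" using u(3) by blast
  have a: "a \<in> ?C" using imageI[OF ab, of fst] by simp
  have "b \<in> snd ` set p" using imageI[OF ab, of snd] by simp
  then have b: "b \<in> ?C" using closed_walk_heads_eq_tails[OF u(1,2)] by simp
  have "a \<noteq> b" using tournament_onD(8)[OF T abE] .
  obtain c where c: "c \<in> ?C - {b}" "(b, c) \<in> parcs T"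
    using cut[of "{b}"] a b \<open>a \<noteq> b\<close> by blast
  have "c \<noteq> a" using tournament_onD(6)[OF T abE] c(2) by blast
  then have "card {a, b, c} = 3" using \<open>a \<noteq> b\<close> c(1) by auto
  moreover have "{a, b, c} \<subseteq> ?C" using a b c(1) by blast
  ultimately have "3 \<le> card ?C" by (metis card_mono finite_imageI finite_set)
  then show "strong (parcs T) ?C" using cut by (simp add: strong_def)
  show "?C \<subseteq> pverts T" using u(3) tournament_onD(3)[OF T] by force
qed

lemma strongD: "strong E C \<Longrightarrow> X \<noteq> {} \<Longrightarrow> X \<subset> C \<Longrightarrow> \<exists>x\<in>X. \<exists>y\<in>C - X. (x, y) \<in> E"
  unfolding strong_def by blast

lemma strong_card: "strong E C \<Longrightarrow> 3 \<le> card C"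
  unfolding strong_def by blast

text \<open>
  If $z$ is an end of every arc that leaves $K$, then removing $z$ separates $K$ from its
  complement as far as directed cycles are concerned.
\<close>

lemma strong_in_or_out:
  assumes C: "strong E C" "z \<notin> C"
    and cut: "\<And>x y. (x, y) \<in> E \<Longrightarrow> x \<in> K \<Longrightarrow> y \<notin> K \<Longrightarrow> x = z \<or> y = z"
  shows "C \<subseteq> K \<or> C \<inter> K = {}"
proof (rule ccontr)
  assume "\<not> ?thesis"
  then have "C \<inter> K \<noteq> {}" "C \<inter> K \<subset> C" by auto
  then obtain x y where "x \<in> C \<inter> K" "y \<in> C - C \<inter> K" "(x, y) \<in> E"
    using strongD[OF C(1), of "C \<inter> K"] by blast
  then show False using cut[of x y] C(2) by blast
qed

definition triangle :: "'a rel \<Rightarrow> 'a \<Rightarrow> 'a \<Rightarrow> 'a \<Rightarrow> bool" where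
  "triangle E a b c \<longleftrightarrow> (a, b) \<in> E \<and> (b, c) \<in> E \<and> (c, a) \<in> E \<or> (b, a) \<in> E \<and> (c, b) \<in> E \<and> (a, c) \<in> E"

lemma strong_triangle:
  assumes T: "tournament_on V E" and C: "strong E {a, b, c}" and d: "distinct [a, b, c]"
  shows "triangle E a b c"
proof -
  have out: "\<exists>y\<in>{a, b, c} - {x}. (x, y) \<in> E" if "x \<in> {a, b, c}" for x
  proof -
    have "{x} \<subset> {a, b, c}" using that d by auto
    then show ?thesis using strongD[OF C, of "{x}"] by blast
  qed
  have "(a, b) \<in> E \<or> (a, c) \<in> E" "(b, a) \<in> E \<or> (b, c) \<in> E" "(c, a) \<in> E \<or> (c, b) \<in> E"
    using out[of a] out[of b] out[of c] d by auto
  then show ?thesis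
    using tournament_onD(6)[OF T] unfolding triangle_def by blast
qed

section \<open>Splitting links by convex separation\<close>

text \<open>
  Stereographic projection from a point. All embeddings are built in $\<real>^3$ and carried to the
  3-sphere by such a chart, which is also the one that witnesses tameness.
\<close>

lemma punctured_sphere_chart:
  obtains p h h' where "p \<in> S3" "homeomorphism (S3 - {p}) (UNIV :: (real^3) set) h h'"
proof -
  obtain p :: "real^4" where p: "norm p = 1"
    using vector_choose_size[of 1] zero_le_one by metis
  have "(S3 - {p}) homeomorphic (UNIV :: (real^3) set)"
    using p by (intro homeomorphic_punctured_sphere_affine) auto
  then show ?thesis
    using that[of p] p unfolding homeomorphic_def by auto
qed

lemma chart_inverse:
  fixes h :: "'a::topological_space \<Rightarrow> 'b::topological_space"
  assumes hom: "homeomorphism X UNIV h h'"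
  shows "h (h' y) = y" "h' ` Z \<subseteq> X" "h' x = h' y \<longleftrightarrow> x = y" "continuous_on Z h'"
proof -
  have hh': "h (h' y) = y" for y using homeomorphism_apply2[OF hom] by simp
  show "h (h' y) = y" by (rule hh')
  show "h' x = h' y \<longleftrightarrow> x = y" using hh' by metis
  show "h' ` Z \<subseteq> X" using homeomorphism_image2[OF hom] by auto
  show "continuous_on Z h'" by (rule continuous_on_subset[OF homeomorphism_cont2[OF hom]]) simp
qed

text \<open>
  A plane strictly separates the two compact convex sets. Cutting a large box along that
  plane gives a polytope that contains $K$ in its interior and misses $L$; its boundary is the
  splitting sphere. It is tame because it is the union of the facets, and it
  separates because the image of the interior is open while the image of the whole polytope is compact.
\<close>

lemma split_link_by_disjoint_hulls:
  fixes h :: "real^4 \<Rightarrow> real^3"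
  assumes p: "p \<in> S3" and hom: "homeomorphism (S3 - {p}) UNIV h h'"
    and K: "compact K" "convex K" "K \<noteq> {}" and L: "compact L" "convex L"
    and disj: "K \<inter> L = {}" and A: "A \<subseteq> h' ` K" and B: "B \<subseteq> h' ` L"
  shows "split_link A B"
proof -
  obtain a b where "(\<forall>x\<in>K. a \<bullet> x < b) \<and> (\<forall>x\<in>L. a \<bullet> x > b)"
    using separating_hyperplane_compact_closed[OF K(2,1,3) L(2) compact_imp_closed[OF L(1)] disj]
    by (elim exE)
  then have Ka: "\<And>x. x \<in> K \<Longrightarrow> a \<bullet> x < b" and La: "\<And>x. x \<in> L \<Longrightarrow> a \<bullet> x > b"
    by simp_all
  obtain s where s: "K \<subseteq> box (- s) s"
    using bounded_subset_box_symmetric[OF compact_imp_bounded[OF K(1)]] .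
  define H where "H = {x. a \<bullet> x \<le> b}"
  \<comment> \<open>the part of a large box on the side of $K$\<close>
  define Q where "Q = cbox (- s) s \<inter> H"
  have Q: "polytope Q"
    unfolding Q_def H_def by (intro polytope_Int_polyhedron polytope_interval polyhedron_halfspace_le)
  have "box (- s) s \<inter> {x. a \<bullet> x < b} \<subseteq> interior Q"
    unfolding Q_def H_def
    by (intro interior_maximal open_Int open_box open_halfspace_lt Int_mono box_subset_cbox)
       (simp add: subset_iff less_imp_le)
  then have KQ: "K \<subseteq> interior Q" using s Ka by blast
  have LQ: "L \<inter> Q = {}"
    using La by (force simp: Q_def H_def)
  have dim: "aff_dim Q = 3"
    using aff_dim_nonempty_interior[of Q] KQ K(3) by auto
  then have fr: "rel_frontier Q = frontier Q"
    using KQ K(3) by (metis rel_frontier_nonempty_interior subset_empty)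
  note hh' = chart_inverse(1)[OF hom] and sub = chart_inverse(2)[OF hom]
    and inj = chart_inverse(3)[OF hom] and conth' = chart_inverse(4)[OF hom]
  have rng: "h' y \<in> S3 - {p}" for y
    by (rule subsetD[OF sub[of UNIV]]) (rule rangeI)
  let ?S = "h' ` frontier Q"
  have "h ` ?S = frontier Q" by (simp only: image_image hh' image_ident)
  also have "\<dots> = \<Union> {F. F facet_of Q}"
    using fr rel_frontier_of_polyhedron[OF polytope_imp_polyhedron[OF Q]] by simp
  finally have hS: "h ` ?S = \<Union> {F. F facet_of Q}" .
  have "tame 2 ?S"
    unfolding tame_def
  proof (intro conjI exI)
    show "?S \<subseteq> S3" "p \<in> S3 - ?S" using sub[of "frontier Q"] p by auto
    show "homeomorphism (S3 - {p}) UNIV h h'" by fact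
    show "h ` ?S = \<Union> {F. F facet_of Q}" by (fact hS)
    show "finite {F. F facet_of Q}" by (rule finite_polytope_facets[OF Q])
    show "\<forall>P\<in>{F. F facet_of Q}. polytope P \<and> aff_dim P \<le> 2"
      using face_of_polytope_polytope[OF Q] dim by (auto simp: facet_of_def)
  qed
  moreover have "?S homeomorphic sphere (0 :: real^3) 1"
  proof -
    have "homeomorphism (frontier Q) ?S h' h"
      by (rule homeomorphism_of_subsets[OF homeomorphism_symD[OF hom] subset_UNIV sub refl])
    then have "frontier Q homeomorphic ?S"
      unfolding homeomorphic_def by blast
    then have "?S homeomorphic rel_frontier Q"
      unfolding fr by (rule homeomorphic_sym[THEN iffD1])
    also have "rel_frontier Q homeomorphic rel_frontier (cball (0 :: real^3) 1)"
      using Q dim by (intro homeomorphic_rel_frontiers_convex_bounded_sets)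
        (auto simp: polytope_imp_convex polytope_imp_bounded aff_dim_cball)
    also have "rel_frontier (cball (0 :: real^3) 1) = sphere 0 1" by simp
    finally show ?thesis .
  qed
  moreover have "?S \<subseteq> S3 - (A \<union> B)"
  proof -
    have "K \<inter> frontier Q = {}" "L \<inter> frontier Q = {}"
      using KQ LQ polytope_imp_closed[OF Q] by (auto simp: frontier_def)
    moreover have "h' ` X \<inter> h' ` Y = h' ` (X \<inter> Y)" for X Y
      using inj by (intro image_Int[symmetric] injI) simp
    ultimately have "?S \<inter> h' ` K = {}" "?S \<inter> h' ` L = {}"
      by (metis Int_commute image_empty)+
    then have "?S \<inter> A = {}" "?S \<inter> B = {}"
      using A B by auto
    then show ?thesis using sub[of "frontier Q"] by auto
  qed
  moreover have "\<not> connected_component (S3 - ?S) x y" if x: "x \<in> A" and y: "y \<in> B" for x y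
  proof
    assume "connected_component (S3 - ?S) x y"
    then obtain C where C: "connected C" "C \<subseteq> S3 - ?S" "x \<in> C" "y \<in> C"
      unfolding connected_component_def by blast
    let ?U = "h' ` interior Q" and ?W = "S3 - h' ` Q"
    have "openin (top_of_set (S3 - {p})) ?U"
      using homeomorphism_imp_open_map[OF homeomorphism_symD[OF hom], of "interior Q"]
      by (simp only: open_openin[symmetric] open_interior subtopology_UNIV)
    then have U: "openin (top_of_set S3) ?U"
      by (rule openin_trans) (intro openin_delete openin_subtopology_self)
    have "compact (h' ` Q)"
      by (intro compact_continuous_image conth' polytope_imp_compact[OF Q])
    then have W: "openin (top_of_set S3) ?W"
      using sub[of Q] by (intro openin_diff openin_subtopology_self closed_subset compact_imp_closed) auto
    have cov: "C \<subseteq> ?U \<union> ?W"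
    proof
      fix c assume c: "c \<in> C"
      show "c \<in> ?U \<union> ?W"
      proof (cases "c \<in> h' ` Q")
        case True
        then have "c \<in> ?U \<union> ?S"
          using polytope_imp_closed[OF Q] by (auto simp: frontier_def)
        then show ?thesis using c C(2) by blast
      qed (use c C(2) in blast)
    qed
    have xU: "x \<in> ?U" using x A KQ by blast
    have yW: "y \<in> ?W"
    proof -
      obtain l where "l \<in> L" "y = h' l" using y B by blast
      then show ?thesis using LQ rng[of l] by (auto simp: inj)
    qed
    have "?U \<subseteq> h' ` Q" using interior_subset by (rule image_mono)
    then have UW: "?U \<inter> ?W = {}" by auto
    obtain T1 where T1: "open T1" "?U = S3 \<inter> T1"
      using U unfolding openin_open by (elim exE conjE)
    obtain T2 where T2: "open T2" "?W = S3 \<inter> T2"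
      using W unfolding openin_open by (elim exE conjE)
    have "C \<subseteq> S3" using C(2) by blast
    then have CU: "C \<inter> ?U = T1 \<inter> C" and CW: "C \<inter> ?W = T2 \<inter> C"
      unfolding T1(2) T2(2) by auto
    have "T1 \<inter> T2 \<inter> C = (C \<inter> ?U) \<inter> (C \<inter> ?W)"
      unfolding CU CW by auto
    then have "T1 \<inter> T2 \<inter> C = {}" using UW by auto
    moreover have "C \<subseteq> (C \<inter> ?U) \<union> (C \<inter> ?W)" using cov by auto
    then have "C \<subseteq> T1 \<union> T2" unfolding CU CW by auto
    moreover have "x \<in> T1 \<inter> C" "y \<in> T2 \<inter> C"
      using xU yW C(3,4) unfolding CU[symmetric] CW[symmetric] by auto
    ultimately show False
      using connectedD[OF C(1) T1(1) T2(1)] by (metis empty_iff)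
  qed
  ultimately show ?thesis
    unfolding split_link_def by (intro exI[of _ ?S] conjI ballI) simp_all
qed

section \<open>Tournaments on the moment curve\<close>

definition moment :: "real \<Rightarrow> real^3" where
  "moment t = vector [t, t\<^sup>2, t ^ 3]"

text \<open>
  The affine functions on $\<real>^3$, pulled back along the moment curve: exactly the polynomials of
  degree at most three.
\<close>

definition cubics :: "(real \<Rightarrow> real) set" where
  "cubics = {q. \<exists>v c. \<forall>t. q t = v \<bullet> moment t + c}"

lemma cubics_closed:
  "(\<lambda>t. c) \<in> cubics"
  "p \<in> cubics \<Longrightarrow> q \<in> cubics \<Longrightarrow> (\<lambda>t. p t + q t) \<in> cubics"
  "p \<in> cubics \<Longrightarrow> (\<lambda>t. c * p t) \<in> cubics"
proof -
  show "(\<lambda>t. c) \<in> cubics"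
    unfolding cubics_def by (intro CollectI exI[of _ 0] exI[of _ c]) simp
  show "(\<lambda>t. p t + q t) \<in> cubics" if pq: "p \<in> cubics" "q \<in> cubics"
  proof -
    obtain v c w d where "\<And>t. p t = v \<bullet> moment t + c" "\<And>t. q t = w \<bullet> moment t + d"
      using pq by (auto simp: cubics_def)
    then show ?thesis
      unfolding cubics_def by (intro CollectI exI[of _ "v + w"] exI[of _ "c + d"])
        (simp add: inner_add_left)
  qed
  show "(\<lambda>t. c * p t) \<in> cubics" if p: "p \<in> cubics"
  proof -
    obtain v d where "\<And>t. p t = v \<bullet> moment t + d"
      using p by (auto simp: cubics_def)
    then show ?thesis
      unfolding cubics_def by (intro CollectI exI[of _ "c *\<^sub>R v"] exI[of _ "c * d"])
        (simp add: distrib_left)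
  qed
qed

lemma cubics_poly: "(\<lambda>t. c0 + c1 * t + c2 * t\<^sup>2 + c3 * t ^ 3) \<in> cubics"
  unfolding cubics_def
  by (intro CollectI exI[of _ "vector [c1, c2, c3]"] exI[of _ c0])
    (simp add: moment_def inner_vec_def sum_3)

lemma cubics_factors:
  "(\<lambda>t. t - a) \<in> cubics" "(\<lambda>t. (t - a) * (t - b)) \<in> cubics"
  "(\<lambda>t. (t - a) * (t - b) * (t - c)) \<in> cubics"
proof -
  have "(\<lambda>t. t - a) = (\<lambda>t. - a + 1 * t + 0 * t\<^sup>2 + 0 * t ^ 3)" by auto
  then show "(\<lambda>t. t - a) \<in> cubics" by (simp only: cubics_poly)
  have "(\<lambda>t. (t - a) * (t - b)) = (\<lambda>t. a * b + (- a - b) * t + 1 * t\<^sup>2 + 0 * t ^ 3)"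
    by (auto simp: algebra_simps power2_eq_square)
  then show "(\<lambda>t. (t - a) * (t - b)) \<in> cubics" by (simp only: cubics_poly)
  have "(\<lambda>t. (t - a) * (t - b) * (t - c)) =
    (\<lambda>t. - a * b * c + (a * b + a * c + b * c) * t + (- a - b - c) * t\<^sup>2 + 1 * t ^ 3)"
    by (auto simp: algebra_simps power2_eq_square power3_eq_cube)
  then show "(\<lambda>t. (t - a) * (t - b) * (t - c)) \<in> cubics" by (simp only: cubics_poly)
qed

text \<open>
  Newton interpolation through four points. It says that no four points of the moment curve lie in a
  plane, so chords of the curve are in general position.
\<close>

lemma cubic_interpolation:
  assumes "distinct [a, b, c, d]"
  shows "\<exists>q\<in>cubics. q a = ya \<and> q b = yb \<and> q c = yc \<and> q d = yd"
proof -
  define k1 where "k1 = (yb - ya) / (b - a)"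
  define k2 where "k2 = (yc - ya - k1 * (c - a)) / ((c - a) * (c - b))"
  define k3 where "k3 = (yd - ya - k1 * (d - a) - k2 * ((d - a) * (d - b))) / ((d - a) * (d - b) * (d - c))"
  define q where "q = (\<lambda>t. ya + k1 * (t - a) + k2 * ((t - a) * (t - b)) + k3 * ((t - a) * (t - b) * (t - c)))"
  have "q \<in> cubics"
    unfolding q_def by (intro cubics_closed cubics_factors)
  moreover have "q a = ya" by (simp add: q_def)
  moreover have "q b = yb" using assms by (simp add: q_def k1_def)
  moreover have "q c = yc" using assms by (simp add: q_def k2_def)
  moreover have "q d = yd"
  proof -
    have "k3 * ((d - a) * (d - b) * (d - c)) = yd - ya - k1 * (d - a) - k2 * ((d - a) * (d - b))"
      using assms by (simp add: k3_def)
    then show ?thesis by (simp add: q_def)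
  qed
  ultimately show ?thesis by (intro bexI[of _ q] conjI)
qed

definition cubically_separated :: "real set \<Rightarrow> real set \<Rightarrow> bool" where
  "cubically_separated A B \<longleftrightarrow> (\<exists>q\<in>cubics. (\<forall>t\<in>A. q t > 0) \<and> (\<forall>t\<in>B. q t < 0))"

lemma cubically_separated_sym: "cubically_separated A B \<Longrightarrow> cubically_separated B A"
proof -
  assume "cubically_separated A B"
  then obtain q where "q \<in> cubics" "\<forall>t\<in>A. q t > 0" "\<forall>t\<in>B. q t < 0"
    by (auto simp: cubically_separated_def)
  then show ?thesis
    unfolding cubically_separated_def
    by (intro bexI[of _ "\<lambda>t. -1 * q t"] cubics_closed(3)) auto
qed

lemma cubically_separated_hulls:
  assumes "cubically_separated A B"
  shows "convex hull (moment ` A) \<inter> convex hull (moment ` B) = {}"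
proof -
  obtain q where "q \<in> cubics" and q: "\<forall>t\<in>A. q t > 0" "\<forall>t\<in>B. q t < 0"
    using assms by (auto simp: cubically_separated_def)
  then obtain v c where vc: "\<And>t. q t = v \<bullet> moment t + c" by (auto simp: cubics_def)
  have "moment ` A \<subseteq> {x. v \<bullet> x > - c}" "moment ` B \<subseteq> {x. v \<bullet> x < - c}"
    using q unfolding vc by (auto simp: algebra_simps)
  then have "convex hull (moment ` A) \<subseteq> {x. v \<bullet> x > - c}" "convex hull (moment ` B) \<subseteq> {x. v \<bullet> x < - c}"
    by (simp_all add: hull_minimal convex_halfspace_gt convex_halfspace_lt)
  then show ?thesis by fastforce
qed

text \<open>
  An affine function takes only one value at a common point of two chords.
\<close>

lemma cubic_on_chords:
  assumes "q \<in> cubics"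
    and eq: "(1 - r) *\<^sub>R moment a + r *\<^sub>R moment b = (1 - s) *\<^sub>R moment c + s *\<^sub>R moment d"
  shows "(1 - r) * q a + r * q b = (1 - s) * q c + s * q d"
proof -
  obtain v k where vk: "\<And>t. q t = v \<bullet> moment t + k" using assms by (auto simp: cubics_def)
  have "(1 - r) * q a + r * q b = v \<bullet> ((1 - r) *\<^sub>R moment a + r *\<^sub>R moment b) + k" for a b r
    by (simp add: vk inner_add_right algebra_simps)
  then show ?thesis using eq by simp
qed

text \<open>
  The polynomial $(t - v)^2$ vanishes at $v$ and is positive at all other points, hence on
  every chord that does not end at $v$.
\<close>

lemma moment_chord_vertex:
  assumes "moment v \<in> closed_segment (moment a) (moment b)"
  shows "v \<in> {a, b}"
proof (rule ccontr)
  assume "v \<notin> {a, b}"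
  then have pos: "(a - v) * (a - v) > 0" "(b - v) * (b - v) > 0"
    by (auto simp: zero_less_mult_iff)
  obtain s where s: "0 \<le> s" "s \<le> 1" "moment v = (1 - s) *\<^sub>R moment a + s *\<^sub>R moment b"
    using assms unfolding in_segment by blast
  have "(1 - 0) * ((v - v) * (v - v)) + 0 * ((v - v) * (v - v))
    = (1 - s) * ((a - v) * (a - v)) + s * ((b - v) * (b - v))"
    by (rule cubic_on_chords[OF cubics_factors(2)]) (use s(3) in simp)
  then have "(1 - s) * ((a - v) * (a - v)) + s * ((b - v) * (b - v)) = 0" by simp
  moreover have "(1 - s) * ((a - v) * (a - v)) + s * ((b - v) * (b - v)) > 0"
  proof (cases "s = 0")
    case True
    then show ?thesis using pos by simp
  next
    case False
    then have "s * ((b - v) * (b - v)) > 0" using s(1) pos by simp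
    moreover have "(1 - s) * ((a - v) * (a - v)) \<ge> 0" using s(2) pos by simp
    ultimately show ?thesis by linarith
  qed
  ultimately show False by simp
qed

lemma moment_inj: "moment a = moment b \<longleftrightarrow> a = b"
  using moment_chord_vertex[of a b b] by auto

lemma moment_chords_disjoint:
  assumes "distinct [a, b, c, d]"
  shows "closed_segment (moment a) (moment b) \<inter> closed_segment (moment c) (moment d) = {}"
proof -
  obtain q where "q \<in> cubics" "q a = 1" "q b = 1" "q c = - 1" "q d = - 1"
    using cubic_interpolation[OF assms, of 1 1 "- 1" "- 1"] by (elim bexE conjE)
  then have "cubically_separated {a, b} {c, d}"
    unfolding cubically_separated_def by (intro bexI[of _ q]) auto
  then show ?thesis
    using cubically_separated_hulls by (fastforce simp: segment_convex_hull)
qed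

text \<open>
  A cubic that vanishes at the common end and has opposite signs at the two other ends
  separates the chords except at the common end. The fourth interpolation point is arbitrary.
\<close>

lemma moment_chords_common_end:
  assumes "distinct [a, b, d]"
  shows "closed_segment (moment a) (moment b) \<inter> closed_segment (moment a) (moment d) \<subseteq> {moment a}"
proof
  fix x
  assume x: "x \<in> closed_segment (moment a) (moment b) \<inter> closed_segment (moment a) (moment d)"
  \<comment> \<open>a fourth point, only to apply the interpolation lemma\<close>
  obtain e :: real where "e \<notin> {a, b, d}"
    using ex_new_if_finite[OF infinite_UNIV_char_0, of "{a, b, d}"] by blast
  then have dist: "distinct [a, b, d, e]" using assms by auto
  obtain q where q: "q \<in> cubics" "q a = 0" "q b = 1" "q d = - 1" "q e = 0"
    using cubic_interpolation[OF dist, of 0 1 "- 1" 0] by blast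
  have "x \<in> closed_segment (moment a) (moment b)" "x \<in> closed_segment (moment a) (moment d)"
    using x by simp_all
  then obtain s r where s: "0 \<le> s" "x = (1 - s) *\<^sub>R moment a + s *\<^sub>R moment b"
    and r: "0 \<le> r" "x = (1 - r) *\<^sub>R moment a + r *\<^sub>R moment d"
    unfolding in_segment by (elim exE conjE)
  have "(1 - s) * q a + s * q b = (1 - r) * q a + r * q d"
    by (rule cubic_on_chords[OF q(1)]) (use s(2) r(2) in simp)
  then have "s = - r" using q by simp
  then have "s = 0" using s(1) r(1) by simp
  then show "x \<in> {moment a}" using s(2) by simp
qed

lemma moment_chords_meet:
  assumes "a \<noteq> b" "c \<noteq> d" "{a, b} \<noteq> {c, d}"
  shows "closed_segment (moment a) (moment b) \<inter> closed_segment (moment c) (moment d)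
    \<subseteq> moment ` ({a, b} \<inter> {c, d})"
proof -
  consider "distinct [a, b, c, d]" | "c = a" "distinct [a, b, d]" | "d = a" "distinct [a, b, c]"
    | "c = b" "distinct [b, a, d]" | "d = b" "distinct [b, a, c]"
    using assms by (auto simp: doubleton_eq_iff)
  then show ?thesis
  proof cases
    case 1
    then show ?thesis by (simp only: moment_chords_disjoint empty_subsetI)
  next
    case 2
    show ?thesis
      unfolding 2(1) by (rule subset_trans[OF moment_chords_common_end[OF 2(2)]]) simp
  next
    case 3
    show ?thesis
      unfolding 3(1) closed_segment_commute[of "moment c" "moment a"]
      by (rule subset_trans[OF moment_chords_common_end[OF 3(2)]]) simp
  next
    case 4
    show ?thesis
      unfolding 4(1) closed_segment_commute[of "moment a" "moment b"]
      by (rule subset_trans[OF moment_chords_common_end[OF 4(2)]]) simp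
  next
    case 5
    show ?thesis
      unfolding 5(1) closed_segment_commute[of "moment a" "moment b"] closed_segment_commute[of "moment c" "moment b"]
      by (rule subset_trans[OF moment_chords_common_end[OF 5(2)]]) simp
  qed
qed

lemma polytope_segment: "polytope (closed_segment a b)" "aff_dim (closed_segment a b) \<le> 1"
proof -
  show "polytope (closed_segment a b)"
    unfolding segment_convex_hull polytope_def by (intro exI[of _ "{a, b}"]) simp
  show "aff_dim (closed_segment a b) \<le> 1"
    by (simp add: segment_convex_hull aff_dim_convex_hull)
qed

lemma moment_tame_embedding:
  fixes h :: "real^4 \<Rightarrow> real^3"
  assumes T: "tournament_on (pverts T) (parcs T)" and inj: "inj_on t (pverts T)"
    and p: "p \<in> S3" and hom: "homeomorphism (S3 - {p}) UNIV h h'"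
  shows "tame_embedding (with_proj T) (\<lambda>v. h' (moment (t v)))
    (\<lambda>e. h' \<circ> linepath (moment (t (fst e))) (moment (t (snd e))))"
    (is "tame_embedding _ ?f ?g")
proof -
  define m where "m v = moment (t v)" for v
  define seg where "seg e = closed_segment (m (fst e)) (m (snd e))" for e
  note hh' = chart_inverse(1)[OF hom] and rng = chart_inverse(2)[OF hom]
    and injh = chart_inverse(3)[OF hom] and conth' = chart_inverse(4)[OF hom]
  have mi: "m u = m v \<longleftrightarrow> u = v" if "u \<in> pverts T" "v \<in> pverts T" for u v
    using inj that by (simp add: m_def moment_inj inj_on_eq_iff)
  have ends: "fst e \<in> pverts T" "snd e \<in> pverts T" "fst e \<noteq> snd e" if "e \<in> parcs T" for e
    using tournament_onD(3,4,8)[OF T, of "fst e" "snd e"] that by simp_all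
  have pg: "path_image (?g e) = h' ` seg e" for e
    by (simp add: path_image_compose seg_def m_def)
  have eg: "embedded_graph (with_proj T) ?f ?g = h' ` (m ` pverts T \<union> (\<Union>e\<in>parcs T. seg e))"
    unfolding embedded_graph_def pg with_proj_simps by (simp add: image_Un image_UN image_image m_def)
  have "embedding (with_proj T) ?f ?g"
    unfolding embedding_def with_proj_simps pg
  proof (intro conjI ballI impI)
    show "embedded_graph (with_proj T) ?f ?g \<subseteq> S3" unfolding eg using rng by blast
    show "inj_on ?f (pverts T)" using mi by (intro inj_onI) (simp add: injh m_def)
  next
    fix e assume e: "e \<in> parcs T"
    have "simple_path (linepath (m (fst e)) (m (snd e)))"
      using ends[OF e] mi by (intro simple_path_linepath) blast
    then show "simple_path (?g e)"
      unfolding m_def by (intro simple_path_continuous_image conth' inj_onI) (simp_all add: injh)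
    show "pathstart (?g e) = ?f (fst e)" "pathfinish (?g e) = ?f (snd e)"
      by (simp_all add: pathstart_compose pathfinish_compose)
    fix v assume v: "v \<in> pverts T" "?f v \<in> h' ` seg e"
    then have "m v \<in> seg e" by (auto simp: injh m_def)
    then have "t v \<in> {t (fst e), t (snd e)}" unfolding seg_def m_def by (rule moment_chord_vertex)
    then show "v \<in> {fst e, snd e}" using inj v(1) ends[OF e] by (auto simp: inj_on_eq_iff)
  next
    fix e e' assume e: "e \<in> parcs T" and e': "e' \<in> parcs T" and ne: "e \<noteq> e'"
    have ne': "{fst e, snd e} \<noteq> {fst e', snd e'}"
    proof
      assume "{fst e, snd e} = {fst e', snd e'}"
      then have "e = e' \<or> e = (snd e', fst e')" by (auto simp: doubleton_eq_iff prod_eq_iff)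
      then show False using ne e e' tournament_onD(6)[OF T, of "fst e'" "snd e'"] by auto
    qed
    have "seg e \<inter> seg e' \<subseteq> moment ` ({t (fst e), t (snd e)} \<inter> {t (fst e'), t (snd e')})"
      unfolding seg_def m_def
    proof (rule moment_chords_meet)
      show "t (fst e) \<noteq> t (snd e)" "t (fst e') \<noteq> t (snd e')"
        using ends[OF e] ends[OF e'] inj by (auto simp: inj_on_eq_iff)
      have "t ` {fst e, snd e} \<noteq> t ` {fst e', snd e'}"
        using inj_on_image_eq_iff[OF inj, of "{fst e, snd e}" "{fst e', snd e'}"] ne' ends[OF e] ends[OF e'] by simp
      then show "{t (fst e), t (snd e)} \<noteq> {t (fst e'), t (snd e')}" by simp
    qed
    also have "\<dots> \<subseteq> m ` ({fst e, snd e} \<inter> {fst e', snd e'})"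
    proof -
      have "t ` {fst e, snd e} \<inter> t ` {fst e', snd e'} = t ` ({fst e, snd e} \<inter> {fst e', snd e'})"
        by (rule inj_on_image_Int[OF inj, symmetric]) (use ends[OF e] ends[OF e'] in auto)
      then show ?thesis by (simp add: m_def image_image[symmetric, of moment t])
    qed
    finally have "h' ` (seg e \<inter> seg e') \<subseteq> h' ` m ` ({fst e, snd e} \<inter> {fst e', snd e'})"
      by (rule image_mono)
    moreover have "h' ` seg e \<inter> h' ` seg e' = h' ` (seg e \<inter> seg e')"
      by (intro image_Int[symmetric] injI) (simp add: injh)
    ultimately show "h' ` seg e \<inter> h' ` seg e' \<subseteq> ?f ` ({fst e, snd e} \<inter> {fst e', snd e'})"
      by (simp add: image_image m_def)
  qed
  moreover have "tame 1 (embedded_graph (with_proj T) ?f ?g)"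
    unfolding tame_def
  proof (intro conjI exI)
    show "embedded_graph (with_proj T) ?f ?g \<subseteq> S3" "p \<in> S3 - embedded_graph (with_proj T) ?f ?g"
      unfolding eg using rng p by blast+
    show "homeomorphism (S3 - {p}) UNIV h h'" by fact
    let ?P = "(\<lambda>v. {m v}) ` pverts T \<union> seg ` parcs T"
    show "finite ?P" using tournament_onD(1,2)[OF T] by simp
    show "\<forall>P\<in>?P. polytope P \<and> aff_dim P \<le> 1"
      using polytope_segment by (auto simp: seg_def polytope_sing)
    show "h ` embedded_graph (with_proj T) ?f ?g = \<Union> ?P"
      unfolding eg by (auto simp: image_image hh' image_Un)
  qed
  ultimately show ?thesis unfolding tame_embedding_def by simp
qed

text \<open>
  The parameter $t$ places the vertices along the moment curve. Only their order matters: the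
  condition says that two disjoint strong sets change over at most three times along the curve.
\<close>

definition curve_orderable :: "'a set \<Rightarrow> 'a rel \<Rightarrow> bool" where
  "curve_orderable V E \<longleftrightarrow> (\<exists>t::'a \<Rightarrow> real. inj_on t V \<and>
     (\<forall>A B. A \<subseteq> V \<longrightarrow> B \<subseteq> V \<longrightarrow> A \<inter> B = {} \<longrightarrow> strong E A \<longrightarrow> strong E B \<longrightarrow>
        cubically_separated (t ` A) (t ` B)))"

text \<open>
  The chords of a cycle lie in the convex hull of its vertices.
\<close>

lemma curve_orderable_not_linked:
  assumes T: "tournament_on (pverts T) (parcs T)" and ord: "curve_orderable (pverts T) (parcs T)"
  shows "\<not> intrinsically_linked (with_proj T)"
proof -
  obtain t :: "'a \<Rightarrow> real" where inj: "inj_on t (pverts T)"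
    and sep: "\<And>A B. A \<subseteq> pverts T \<Longrightarrow> B \<subseteq> pverts T \<Longrightarrow> A \<inter> B = {} \<Longrightarrow> strong (parcs T) A \<Longrightarrow>
      strong (parcs T) B \<Longrightarrow> cubically_separated (t ` A) (t ` B)"
    using ord unfolding curve_orderable_def by blast
  obtain p and h :: "real^4 \<Rightarrow> real^3" and h'
    where p: "p \<in> S3" and hom: "homeomorphism (S3 - {p}) UNIV h h'"
    by (rule punctured_sphere_chart)
  let ?f = "\<lambda>v. h' (moment (t v))"
  let ?g = "\<lambda>e. h' \<circ> linepath (moment (t (fst e))) (moment (t (snd e)))"
  have emb: "tame_embedding (with_proj T) ?f ?g" by (rule moment_tame_embedding[OF T inj p hom])
  have "split_link (\<Union>e\<in>set r. path_image (?g e)) (\<Union>e\<in>set s. path_image (?g e))"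
    if r: "pre_digraph.cycle (with_proj T) r" and s: "pre_digraph.cycle (with_proj T) s"
      and rs: "fst ` set r \<inter> fst ` set s = {}" for r s
  proof -
    define K where "K r = convex hull (moment ` t ` fst ` set r)" for r :: "('a \<times> 'a) list"
    have cover: "(\<Union>e\<in>set r. path_image (?g e)) \<subseteq> h' ` K r"
      if cyc: "pre_digraph.cycle (with_proj T) r" for r
    proof -
      obtain u where u: "pcas u r u" "r \<noteq> []" using cycle_with_projD[OF cyc] .
      have "closed_segment (moment (t (fst e))) (moment (t (snd e))) \<subseteq> K r" if e: "e \<in> set r" for e
      proof -
        have "snd e \<in> fst ` set r" using closed_walk_heads_eq_tails[OF u] e by blast
        then have "moment (t (snd e)) \<in> K r" "moment (t (fst e)) \<in> K r"
          using e unfolding K_def by (simp_all add: hull_inc)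
        then show ?thesis unfolding K_def by (intro closed_segment_subset convex_convex_hull)
      qed
      then have "path_image (?g e) \<subseteq> h' ` K r" if "e \<in> set r" for e
        using that unfolding path_image_compose path_image_linepath by (intro image_mono)
      then show ?thesis by (intro UN_least)
    qed
    have "K r \<inter> K s = {}"
      unfolding K_def
      by (intro cubically_separated_hulls sep cycle_strong[OF T r] cycle_strong[OF T s] rs)
    moreover have "compact (K q)" "convex (K q)" for q
      by (simp_all add: K_def finite_imp_compact_convex_hull)
    moreover have "K r \<noteq> {}"
      using cycle_with_projD[OF r] by (auto simp: K_def)
    ultimately show ?thesis
      by (intro split_link_by_disjoint_hulls[OF p hom _ _ _ _ _ _ cover[OF r] cover[OF s]])
  qed
  then have "\<not> has_nonsplit_consistent_link (with_proj T) ?g"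
    unfolding has_nonsplit_consistent_link_def with_proj_simps by blast
  then show ?thesis using emb unfolding intrinsically_linked_def by blast
qed

section \<open>Adding a source or a sink to an embedding\<close>

text \<open>
  Finitely many proper affine subspaces have measure zero.
\<close>

lemma point_off_planes:
  fixes \<S> :: "(real^3) set set"
  assumes "finite \<S>" "\<And>S. S \<in> \<S> \<Longrightarrow> aff_dim S \<le> 2"
  shows "\<exists>q. \<forall>S\<in>\<S>. q \<notin> affine hull S"
proof -
  have "negligible (affine hull S)" if "S \<in> \<S>" for S
  proof -
    have "interior (affine hull S) = {}"
      using aff_dim_nonempty_interior[of "affine hull S"] assms(2)[OF that] by auto
    then show ?thesis
      by (simp add: negligible_convex_interior affine_imp_convex)
  qed
  then have "negligible (\<Union>S\<in>\<S>. affine hull S)"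
    using assms(1) by (intro negligible_Union) auto
  then have "(\<Union>S\<in>\<S>. affine hull S) \<noteq> UNIV"
    using non_negligible_UNIV by metis
  then show ?thesis by auto
qed

text \<open>
  If the segment from $q$ to $y$ met $P$ at another point $x$, then $q$ would lie on the line through $x$ and $y$.
\<close>

lemma segment_meets_only_at_end:
  fixes q :: "'a::euclidean_space"
  assumes "q \<notin> affine hull (insert y P)"
  shows "closed_segment q y \<inter> P \<subseteq> {y}"
proof
  fix x assume x: "x \<in> closed_segment q y \<inter> P"
  then have "x \<in> closed_segment q y" by simp
  then obtain s where s: "x = (1 - s) *\<^sub>R q + s *\<^sub>R y"
    unfolding in_segment by (elim exE conjE)
  have "s = 1"
  proof (rule ccontr)
    assume "s \<noteq> 1"
    have "(1 / (1 - s)) *\<^sub>R x + (- s / (1 - s)) *\<^sub>R y \<in> affine hull (insert y P)"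
      by (rule mem_affine) (use x \<open>s \<noteq> 1\<close> in \<open>auto simp: hull_inc field_simps\<close>)
    moreover have "(1 / (1 - s)) *\<^sub>R x + (- s / (1 - s)) *\<^sub>R y = q"
      using \<open>s \<noteq> 1\<close> by (simp add: s scaleR_add_right)
    ultimately show False using assms by simp
  qed
  then show "x \<in> {y}" using s by simp
qed

lemma segments_meet_only_at_apex:
  fixes q :: "'a::euclidean_space"
  assumes "q \<notin> affine hull {y, z}" "y \<noteq> z"
  shows "closed_segment q y \<inter> closed_segment q z \<subseteq> {q}"
proof
  fix x assume x: "x \<in> closed_segment q y \<inter> closed_segment q z"
  then have "x \<in> closed_segment q y" "x \<in> closed_segment q z" by simp_all
  then obtain r s where r: "x = (1 - r) *\<^sub>R q + r *\<^sub>R y" and s: "x = (1 - s) *\<^sub>R q + s *\<^sub>R z"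
    unfolding in_segment by (elim exE conjE)
  have eq: "(r - s) *\<^sub>R q = r *\<^sub>R y - s *\<^sub>R z"
    using r s by (simp add: algebra_simps)
  have "r = s"
  proof (rule ccontr)
    assume "r \<noteq> s"
    have "(r / (r - s)) *\<^sub>R y + (- s / (r - s)) *\<^sub>R z \<in> affine hull {y, z}"
    proof (rule mem_affine)
      show "r / (r - s) + - s / (r - s) = 1"
        using \<open>r \<noteq> s\<close> unfolding add_divide_distrib[symmetric] by simp
    qed (simp_all add: hull_inc)
    moreover have "(r / (r - s)) *\<^sub>R y + (- s / (r - s)) *\<^sub>R z = (1 / (r - s)) *\<^sub>R ((r - s) *\<^sub>R q)"
      unfolding eq by (simp add: scaleR_diff_right)
    moreover have "(1 / (r - s)) *\<^sub>R ((r - s) *\<^sub>R q) = q"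
      using \<open>r \<noteq> s\<close> by simp
    ultimately show False using assms(1) by simp
  qed
  then have "r *\<^sub>R y = r *\<^sub>R z" using eq by simp
  then have "r = 0" using assms(2) by simp
  then show "x \<in> {q}" using r by simp
qed

definition remove_vertex :: "'a pair_pre_digraph \<Rightarrow> 'a \<Rightarrow> 'a pair_pre_digraph" where
  "remove_vertex T v = \<lparr>pverts = pverts T - {v}, parcs = {e \<in> parcs T. fst e \<noteq> v \<and> snd e \<noteq> v}\<rparr>"

lemma remove_vertex_simps [simp]:
  "pverts (remove_vertex T v) = pverts T - {v}"
  "parcs (remove_vertex T v) = {e \<in> parcs T. fst e \<noteq> v \<and> snd e \<noteq> v}"
  by (simp_all add: remove_vertex_def)

lemma tournament_on_remove_vertex:
  assumes "tournament_on (pverts T) (parcs T)"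
  shows "tournament_on (pverts (remove_vertex T v)) (parcs (remove_vertex T v))"
proof -
  note D = tournament_onD[OF assms]
  show ?thesis
    unfolding tournament_on_def remove_vertex_simps
  proof (intro conjI ballI allI impI)
    fix a b assume ab: "a \<in> pverts T - {v}" "b \<in> pverts T - {v}" "a \<noteq> b"
    then have "(a, b) \<in> parcs T \<longleftrightarrow> (b, a) \<notin> parcs T"
      using D(6)[of a b] D(7)[of a b] by blast
    then show "((a, b) \<in> {e \<in> parcs T. fst e \<noteq> v \<and> snd e \<noteq> v}) = ((b, a) \<notin> {e \<in> parcs T. fst e \<noteq> v \<and> snd e \<noteq> v})"
      using ab by simp
  qed (use D(1,3,4,5) in auto)
qed

text \<open>
  The new vertex goes to a point $q$ that avoids the affine hulls of the pieces of the polyhedron,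
  the planes spanned by a vertex and a piece, and the lines through two vertices. The straight segments from $q$ to
  the old vertices then meet the old graph only in their far ends, and one another only in
  $q$. The chart is kept, so tameness costs nothing more than the new segments.
\<close>

lemma extend_tame_embedding:
  assumes T: "tournament_on (pverts T) (parcs T)" and v: "v \<in> pverts T"
    and emb: "tame_embedding (with_proj (remove_vertex T v)) f g"
  obtains f' g' where "tame_embedding (with_proj T) f' g'"
    "\<And>e. e \<in> parcs (remove_vertex T v) \<Longrightarrow> g' e = g e"
proof -
  define V' where "V' = pverts T - {v}"
  define E' where "E' = {e \<in> parcs T. fst e \<noteq> v \<and> snd e \<noteq> v}"
  define X where "X = embedded_graph (with_proj (remove_vertex T v)) f g"
  have Xeq: "X = f ` V' \<union> (\<Union>e\<in>E'. path_image (g e))"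
    by (simp add: X_def embedded_graph_def V'_def E'_def)
  have em: "embedding (with_proj (remove_vertex T v)) f g" and tm: "tame 1 X"
    using emb unfolding tame_embedding_def X_def by simp_all
  have XS: "X \<subseteq> S3" and fi: "inj_on f V'"
    and gs: "\<And>e. e \<in> E' \<Longrightarrow> simple_path (g e) \<and> pathstart (g e) = f (fst e) \<and> pathfinish (g e) = f (snd e)"
    and gv: "\<And>e u. e \<in> E' \<Longrightarrow> u \<in> V' \<Longrightarrow> f u \<in> path_image (g e) \<Longrightarrow> u \<in> {fst e, snd e}"
    and gg: "\<And>e e'. e \<in> E' \<Longrightarrow> e' \<in> E' \<Longrightarrow> e \<noteq> e' \<Longrightarrow>
      path_image (g e) \<inter> path_image (g e') \<subseteq> f ` ({fst e, snd e} \<inter> {fst e', snd e'})"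
    using em unfolding embedding_def with_proj_simps remove_vertex_simps
      V'_def[symmetric] E'_def[symmetric] X_def[symmetric] by simp_all
  obtain p and h :: "real^4 \<Rightarrow> real^3" and h' \<P> where p: "p \<in> S3 - X" and hom: "homeomorphism (S3 - {p}) UNIV h h'"
    and P: "finite \<P>" "\<forall>P\<in>\<P>. polytope P \<and> aff_dim P \<le> 1" "h ` X = \<Union>\<P>"
    using tm unfolding tame_def by (elim conjE exE)
  note hh' = chart_inverse(1)[OF hom] and rng = chart_inverse(2)[OF hom]
    and injh = chart_inverse(3)[OF hom] and conth' = chart_inverse(4)[OF hom]
  have Xp: "X \<subseteq> S3 - {p}" using XS p by auto
  have h'h: "h' (h x) = x" if "x \<in> X" for x
    by (rule homeomorphism_apply1[OF hom subsetD[OF Xp that]])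
  define y where "y u = h (f u)" for u
  have fX: "f u \<in> X" if "u \<in> V'" for u using that by (simp add: Xeq)
  have h'y: "h' (y u) = f u" if "u \<in> V'" for u using h'h[OF fX[OF that]] by (simp add: y_def)
  have yi: "y u \<noteq> y w" if "u \<in> V'" "w \<in> V'" "u \<noteq> w" for u w
    using h'y[OF that(1)] h'y[OF that(2)] inj_on_contraD[OF fi that(3,1,2)] by auto
  have fin: "finite V'" "finite (parcs T)" using tournament_onD(1,2)[OF T] by (simp_all add: V'_def)
  define \<S> where "\<S> = \<P> \<union> (\<lambda>(u, P). insert (y u) P) ` (V' \<times> \<P>) \<union> (\<lambda>(u, w). {y u, y w}) ` (V' \<times> V')"
  have finS: "finite \<S>" unfolding \<S>_def using fin(1) P(1) by simp
  have dimS: "aff_dim S \<le> 2" if "S \<in> \<S>" for S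
  proof -
    have "aff_dim (insert (y u) P) \<le> 2" if "P \<in> \<P>" for u P
    proof -
      have "aff_dim P \<le> 1" using P(2) that by blast
      then show ?thesis by (simp add: aff_dim_insert)
    qed
    moreover have "aff_dim P \<le> 2" if "P \<in> \<P>" for P
    proof -
      have "aff_dim P \<le> 1" using P(2) that by blast
      then show ?thesis by simp
    qed
    moreover have "aff_dim {y u, y w} \<le> 2" for u w by simp
    ultimately show ?thesis using that unfolding \<S>_def by (elim UnE imageE) auto
  qed
  obtain q where "\<forall>S\<in>\<S>. q \<notin> affine hull S"
    using point_off_planes[OF finS dimS] by blast
  then have q: "\<And>S. S \<in> \<S> \<Longrightarrow> q \<notin> affine hull S" by blast
  have qX: "q \<notin> h ` X"
  proof
    assume "q \<in> h ` X"
    then obtain P' where "P' \<in> \<P>" "q \<in> P'" using P(3) by auto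
    then show False using q[of P'] hull_inc[of q P' affine] by (simp add: \<S>_def)
  qed
  have s1: "closed_segment q (y u) \<inter> h ` X \<subseteq> {y u}" if "u \<in> V'" for u
  proof
    fix x assume x: "x \<in> closed_segment q (y u) \<inter> h ` X"
    then obtain P' where P': "P' \<in> \<P>" "x \<in> P'" using P(3) by auto
    have "insert (y u) P' \<in> \<S>" using that P'(1) by (force simp: \<S>_def)
    then have "closed_segment q (y u) \<inter> P' \<subseteq> {y u}"
      by (intro segment_meets_only_at_end q)
    then show "x \<in> {y u}" by (rule subsetD) (use x P'(2) in simp)
  qed
  have s2: "closed_segment q (y u) \<inter> closed_segment q (y w) \<subseteq> {q}" if "u \<in> V'" "w \<in> V'" "u \<noteq> w" for u w
  proof (rule segments_meet_only_at_apex[OF q yi[OF that]])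
    show "{y u, y w} \<in> \<S>" using that by (force simp: \<S>_def)
  qed
  have h'qX: "h' q \<notin> X"
  proof
    assume "h' q \<in> X"
    then have "h (h' q) \<in> h ` X" by (rule imageI)
    then show False using qX hh' by simp
  qed
  \<comment> \<open>the old end of a new arc\<close>
  define other where "other e = (if fst e = v then snd e else fst e)" for e
  define N where "N = parcs T - E'"
  define f' where "f' = f(v := h' q)"
  define g' where "g' e = (if e \<in> E' then g e
    else h' \<circ> (if fst e = v then linepath q (y (snd e)) else linepath (y (fst e)) q))" for e
  define seg where "seg e = closed_segment q (y (other e))" for e
  have f'_old: "f' u = f u" if "u \<in> V'" for u using that by (simp add: f'_def V'_def)
  have f'v: "f' v = h' q" by (simp add: f'_def)
  have V: "pverts T = insert v V'" "v \<notin> V'" using v by (auto simp: V'_def)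
  have E: "parcs T = E' \<union> N" "E' \<inter> N = {}" by (auto simp: N_def E'_def)
  have E'V: "fst e \<in> V'" "snd e \<in> V'" if "e \<in> E'" for e
    using that tournament_onD(3,4)[OF T, of "fst e" "snd e"] by (auto simp: E'_def V'_def)
  have N: "other e \<in> V'" "{fst e, snd e} = {v, other e}" if "e \<in> N" for e
    using that tournament_onD(3,4,8)[OF T, of "fst e" "snd e"] by (auto simp: N_def E'_def V'_def other_def)
  have N_inj: "other e \<noteq> other e'" if e: "e \<in> N" "e' \<in> N" "e \<noteq> e'" for e e'
  proof
    assume "other e = other e'"
    then have "{fst e, snd e} = {fst e', snd e'}" using N(2)[OF e(1)] N(2)[OF e(2)] by simp
    then have "e = e' \<or> e = (snd e', fst e')" by (auto simp: doubleton_eq_iff prod_eq_iff)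
    then show False using e tournament_onD(6)[OF T, of "fst e'" "snd e'"] by (auto simp: N_def)
  qed
  have g'E: "g' e = g e" if "e \<in> E'" for e using that by (simp add: g'_def)
  have g'N: "path_image (g' e) = h' ` seg e" if "e \<in> N" for e
    using that by (simp add: g'_def N_def path_image_compose seg_def other_def closed_segment_commute)
  have old: "path_image (g e) \<subseteq> X" if "e \<in> E'" for e using that by (auto simp: Xeq)
  have eg: "embedded_graph (with_proj T) f' g' = X \<union> h' ` ({q} \<union> (\<Union>e\<in>N. seg e))"
  proof -
    have "embedded_graph (with_proj T) f' g' = insert (f' v) (f' ` V') \<union>
        ((\<Union>e\<in>E'. path_image (g' e)) \<union> (\<Union>e\<in>N. path_image (g' e)))"
      unfolding embedded_graph_def with_proj_simps V(1) E(1) by (simp only: image_insert UN_Un)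
    also have "\<dots> = insert (h' q) (f ` V') \<union> ((\<Union>e\<in>E'. path_image (g e)) \<union> (\<Union>e\<in>N. h' ` seg e))"
      using f'_old by (simp add: f'v g'E g'N)
    finally show ?thesis unfolding Xeq by (simp add: image_UN Un_assoc)
  qed
  have egSp: "embedded_graph (with_proj T) f' g' \<subseteq> S3 - {p}"
    unfolding eg by (rule Un_least[OF Xp rng])
  then have egS: "embedded_graph (with_proj T) f' g' \<subseteq> S3" by (rule subset_trans) (rule Diff_subset)
  have old_new: "path_image (g e) \<inter> h' ` seg e' \<subseteq> f' ` ({fst e, snd e} \<inter> {fst e', snd e'})"
    if e: "e \<in> E'" "e' \<in> N" for e e'
  proof
    fix x assume "x \<in> path_image (g e) \<inter> h' ` seg e'"
    then obtain z where x: "x \<in> path_image (g e)" "x = h' z" "z \<in> seg e'" by auto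
    have "z = h x" using x(2) hh' by simp
    then have "z \<in> h ` X" using old[OF e(1)] x(1) by auto
    then have "z = y (other e')" using s1[OF N(1)[OF e(2)]] x(3) by (auto simp: seg_def)
    then have xf: "x = f (other e')" using x(2) h'y[OF N(1)[OF e(2)]] by simp
    then have "other e' \<in> {fst e, snd e}" using gv[OF e(1) N(1)[OF e(2)]] x(1) by simp
    moreover have "other e' \<in> {fst e', snd e'}" using N(2)[OF e(2)] by simp
    ultimately show "x \<in> f' ` ({fst e, snd e} \<inter> {fst e', snd e'})"
      unfolding xf using f'_old[OF N(1)[OF e(2)]] by (metis IntI imageI)
  qed
  have "embedding (with_proj T) f' g'"
    unfolding embedding_def with_proj_simps
  proof (intro conjI ballI impI)
    show "embedded_graph (with_proj T) f' g' \<subseteq> S3" by (fact egS)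
    show "inj_on f' (pverts T)"
    proof -
      have "inj_on f' V'" using fi f'_old by (simp cong: inj_on_cong)
      moreover have "f' v \<notin> f' ` V'"
        using h'qX fX f'_old by (auto simp: f'v)
      ultimately show ?thesis unfolding V(1) using V(2) by simp
    qed
  next
    fix e assume "e \<in> parcs T"
    then consider "e \<in> E'" | "e \<in> N" using E(1) by blast
    then have "simple_path (g' e) \<and> pathstart (g' e) = f' (fst e) \<and> pathfinish (g' e) = f' (snd e)"
    proof cases
      case 1
      then show ?thesis using gs E'V f'_old by (simp add: g'E)
    next
      case 2
      have ne: "q \<noteq> y (other e)" using qX fX[OF N(1)[OF 2]] by (auto simp: y_def)
      have sp: "simple_path (h' \<circ> linepath a b)" if "a \<noteq> b" for a b
        using that by (intro simple_path_continuous_image simple_path_linepath conth' inj_onI) (simp_all add: injh)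
      have "fst e = v \<or> snd e = v" using 2 by (auto simp: N_def E'_def)
      moreover have "e \<notin> E'" using 2 by (simp add: N_def)
      ultimately show ?thesis
        using ne sp f'v f'_old[OF N(1)[OF 2]] h'y[OF N(1)[OF 2]]
        by (auto simp: g'_def other_def pathstart_compose pathfinish_compose split: if_splits)
    qed
    then show "simple_path (g' e)" "pathstart (g' e) = f' (fst e)" "pathfinish (g' e) = f' (snd e)"
      by simp_all
    fix u assume u: "u \<in> pverts T" "f' u \<in> path_image (g' e)"
    show "u \<in> {fst e, snd e}"
    proof (cases "e \<in> E'")
      case True
      then have "f' u \<in> X" using u(2) old[OF True] by (auto simp: g'E)
      then have "u \<noteq> v" using h'qX f'v by auto
      then have "u \<in> V'" using u(1) by (simp add: V'_def)
      then show ?thesis using gv[OF True] u(2) f'_old by (simp add: g'E[OF True])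
    next
      case False
      then have eN: "e \<in> N" using \<open>e \<in> parcs T\<close> by (simp add: N_def)
      show ?thesis
      proof (cases "u = v")
        case True
        then show ?thesis using N(2)[OF eN] by simp
      next
        case False
        then have uV: "u \<in> V'" using u(1) by (simp add: V'_def)
        then have "h' (y u) \<in> h' ` seg e" using u(2) f'_old h'y by (simp add: g'N[OF eN])
        then have "y u \<in> seg e" by (auto simp: injh)
        moreover have "y u \<in> h ` X" using fX[OF uV] by (simp add: y_def)
        ultimately have "y u = y (other e)" using s1[OF N(1)[OF eN]] by (auto simp: seg_def)
        then have "u = other e" using yi[OF uV N(1)[OF eN]] by blast
        then show ?thesis using N(2)[OF eN] by simp
      qed
    qed
  next
    fix e e' assume "e \<in> parcs T" "e' \<in> parcs T" and ne: "e \<noteq> e'"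
    then consider "e \<in> E'" "e' \<in> E'" | "e \<in> E'" "e' \<in> N" | "e \<in> N" "e' \<in> E'" | "e \<in> N" "e' \<in> N"
      using E(1) by blast
    then show "path_image (g' e) \<inter> path_image (g' e') \<subseteq> f' ` ({fst e, snd e} \<inter> {fst e', snd e'})"
    proof cases
      case 1
      have "f' ` ({fst e, snd e} \<inter> {fst e', snd e'}) = f ` ({fst e, snd e} \<inter> {fst e', snd e'})"
        using E'V[OF 1(1)] f'_old by (intro image_cong) auto
      then show ?thesis using gg[OF 1 ne] by (simp only: g'E 1)
    next
      case 2
      then show ?thesis using old_new[OF 2] by (simp only: g'E g'N)
    next
      case 3
      then show ?thesis using old_new[OF 3(2,1)] by (simp only: g'E g'N Int_commute)
    next
      case 4
      have "h' ` seg e \<inter> h' ` seg e' = h' ` (seg e \<inter> seg e')"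
        by (intro image_Int[symmetric] injI) (simp add: injh)
      also have "\<dots> \<subseteq> {h' q}"
        using s2[OF N(1)[OF 4(1)] N(1)[OF 4(2)] N_inj[OF 4 ne]] unfolding seg_def by blast
      also have "\<dots> \<subseteq> f' ` ({fst e, snd e} \<inter> {fst e', snd e'})"
        unfolding N(2)[OF 4(1)] N(2)[OF 4(2)] by (simp add: f'v)
      finally show ?thesis by (simp only: g'N 4)
    qed
  qed
  moreover have "tame 1 (embedded_graph (with_proj T) f' g')"
    unfolding tame_def
  proof (intro conjI exI)
    show "embedded_graph (with_proj T) f' g' \<subseteq> S3" "p \<in> S3 - embedded_graph (with_proj T) f' g'"
      using egSp p by auto
    show "homeomorphism (S3 - {p}) UNIV h h'" by fact
    let ?P = "insert {q} \<P> \<union> seg ` N"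
    show "finite ?P" using P(1) fin(2) by (simp add: N_def)
    show "\<forall>Q\<in>?P. polytope Q \<and> aff_dim Q \<le> 1"
      using P(2) polytope_segment by (auto simp: seg_def polytope_sing)
    show "h ` embedded_graph (with_proj T) f' g' = \<Union> ?P"
      unfolding eg image_Un P(3) by (auto simp: image_image hh')
  qed
  ultimately show ?thesis
    using that[of f' g'] g'E unfolding tame_embedding_def E'_def by simp
qed

text \<open>
  No directed cycle passes through a source or a sink, so the extended embedding has the same
  directed cycles as the given one.
\<close>

lemma not_linked_extend:
  assumes T: "tournament_on (pverts T) (parcs T)" and v: "v \<in> pverts T"
    and end_vertex: "(\<forall>u. (u, v) \<notin> parcs T) \<or> (\<forall>u. (v, u) \<notin> parcs T)"
    and nl: "\<not> intrinsically_linked (with_proj (remove_vertex T v))"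
  shows "\<not> intrinsically_linked (with_proj T)"
proof -
  let ?T' = "remove_vertex T v"
  obtain f g where emb: "tame_embedding (with_proj ?T') f g"
    and nol: "\<not> has_nonsplit_consistent_link (with_proj ?T') g"
    using nl unfolding intrinsically_linked_def by blast
  obtain f' g' where emb': "tame_embedding (with_proj T) f' g'"
    and g': "\<And>e. e \<in> parcs ?T' \<Longrightarrow> g' e = g e"
    using extend_tame_embedding[OF T v emb] by blast
  have cyc: "pre_digraph.cycle (with_proj ?T') r \<and> set r \<subseteq> parcs ?T'"
    if r: "pre_digraph.cycle (with_proj T) r" for r
  proof -
    obtain u where u: "u \<in> pverts T" "pcas u r u" "r \<noteq> []" "set r \<subseteq> parcs T"
      "distinct (tl (pawalk_verts u r))"
      using r unfolding pre_digraph.cycle_def pre_digraph.awalk_def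
      by (auto simp: cas_with_proj_eq awalk_verts_with_proj_eq)
    have vn: "v \<notin> fst ` set r"
    proof
      assume vf: "v \<in> fst ` set r"
      then have vs: "v \<in> snd ` set r" using closed_walk_heads_eq_tails[OF u(2,3)] by simp
      obtain a b where "(v, b) \<in> set r" "(a, v) \<in> set r" using vf vs by auto
      then show False using end_vertex u(4) by blast
    qed
    have "fst e \<noteq> v \<and> snd e \<noteq> v" if "e \<in> set r" for e
      using that vn closed_walk_heads_eq_tails[OF u(2,3)] by (metis imageI)
    then have sub: "set r \<subseteq> parcs ?T'" using u(4) by auto
    have "u \<in> fst ` set r" using u(2,3) by (cases r) auto
    then have "u \<in> pverts ?T'" using vn u(1) by auto
    then have "pre_digraph.cycle (with_proj ?T') r"
      using u(2,3,5) sub unfolding pre_digraph.cycle_def pre_digraph.awalk_def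
      by (auto simp: cas_with_proj_eq awalk_verts_with_proj_eq)
    then show ?thesis using sub by simp
  qed
  have same: "(\<Union>e\<in>set r. path_image (g' e)) = (\<Union>e\<in>set r. path_image (g e))"
    if "set r \<subseteq> parcs ?T'" for r
    using that g' by (intro SUP_cong) auto
  have "\<not> has_nonsplit_consistent_link (with_proj T) g'"
    unfolding has_nonsplit_consistent_link_def with_proj_simps
  proof (intro notI, elim exE conjE)
    fix r s
    assume r: "pre_digraph.cycle (with_proj T) r" and s: "pre_digraph.cycle (with_proj T) s"
      and disj: "fst ` set r \<inter> fst ` set s = {}"
      and ns: "\<not> split_link (\<Union>e\<in>set r. path_image (g' e)) (\<Union>e\<in>set s. path_image (g' e))"
    have "has_nonsplit_consistent_link (with_proj ?T') g"
      unfolding has_nonsplit_consistent_link_def with_proj_simps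
      using ns disj unfolding same[OF conjunct2[OF cyc[OF r]]] same[OF conjunct2[OF cyc[OF s]]]
      by (intro exI[of _ r] exI[of _ s] conjI conjunct1[OF cyc[OF r]] conjunct1[OF cyc[OF s]])
    then show False using nol by simp
  qed
  then show ?thesis using emb' unfolding intrinsically_linked_def by blast
qed

section \<open>Arcs leaving a set of vertices\<close>

text \<open>
  Induction on $K$: a new vertex contributes exactly one arc for each old vertex.
\<close>

lemma card_arcs_within:
  assumes T: "tournament_on V E" and K: "finite K" "K \<subseteq> V"
  shows "card (E \<inter> K \<times> K) = (\<Sum>i<card K. i)"
  using K
proof (induction K)
  case (insert v K)
  let ?N = "{e \<in> E. fst e = v \<and> snd e \<in> K \<or> snd e = v \<and> fst e \<in> K}"
  note D = tournament_onD[OF T]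
  have eq: "E \<inter> insert v K \<times> insert v K = (E \<inter> K \<times> K) \<union> ?N"
    using D(5)[of v] by auto
  have fin: "finite ?N" "finite (E \<inter> K \<times> K)" using D(2) by simp_all
  have disj: "(E \<inter> K \<times> K) \<inter> ?N = {}" using insert.hyps by auto
  have "bij_betw (\<lambda>e. if fst e = v then snd e else fst e) ?N K"
  proof (rule bij_betwI')
    fix e e' assume e: "e \<in> ?N" "e' \<in> ?N"
    show "(if fst e = v then snd e else fst e) = (if fst e' = v then snd e' else fst e') \<longleftrightarrow> e = e'"
      using e D(6) insert.hyps(2) by (cases e; cases e') (auto split: if_splits)
  next
    fix e assume "e \<in> ?N"
    then show "(if fst e = v then snd e else fst e) \<in> K" using insert.hyps(2) by auto
  next
    fix u assume u: "u \<in> K"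
    then have "(u, v) \<in> E \<or> (v, u) \<in> E" using D(7)[of v u] insert.hyps(2) insert.prems by auto
    then show "\<exists>e\<in>?N. u = (if fst e = v then snd e else fst e)"
    proof
      assume "(u, v) \<in> E"
      then show ?thesis using u insert.hyps(2) by (intro bexI[of _ "(u, v)"]) auto
    next
      assume "(v, u) \<in> E"
      then show ?thesis using u insert.hyps(2) by (intro bexI[of _ "(v, u)"]) auto
    qed
  qed
  then have "card ?N = card K" by (rule bij_betw_same_card)
  then show ?case
    unfolding eq card_Un_disjoint[OF fin(2,1) disj] using insert by simp
qed simp

definition outdeg :: "'a rel \<Rightarrow> 'a \<Rightarrow> nat" where
  "outdeg E v = card (E `` {v})"

lemma sum_outdeg:
  assumes T: "tournament_on V E" and K: "K \<subseteq> V"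
  shows "(\<Sum>v\<in>K. outdeg E v) = (\<Sum>i<card K. i) + card (E \<inter> K \<times> (- K))"
proof -
  note D = tournament_onD[OF T]
  have fK: "finite K" using K D(1) by (rule finite_subset)
  have fE: "finite (E `` {v})" for v using D(2) by (rule finite_Image)
  have "(\<Sum>v\<in>K. outdeg E v) = card (SIGMA v:K. E `` {v})"
    unfolding outdeg_def using fK fE by (simp add: card_SigmaI)
  also have "(SIGMA v:K. E `` {v}) = E \<inter> K \<times> K \<union> E \<inter> K \<times> (- K)" by auto
  also have "card \<dots> = card (E \<inter> K \<times> K) + card (E \<inter> K \<times> (- K))"
    using D(2) by (intro card_Un_disjoint) auto
  finally show ?thesis using card_arcs_within[OF T fK K] by simp
qed

section \<open>Tournaments of order nine with a thin cut\<close>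

lemma card_4E:
  assumes "finite A" "card A = 4"
  obtains a b c d where "A = {a, b, c, d}" "distinct [a, b, c, d]"
proof -
  obtain xs where xs: "set xs = A" "distinct xs" using finite_distinct_list[OF assms(1)] by blast
  then have "length xs = 4" using distinct_card[of xs] assms(2) by simp
  then obtain a b c d where "xs = [a, b, c, d]"
    by (auto simp: numeral_eq_Suc length_Suc_conv)
  then show ?thesis using that[of a b c d] xs by auto
qed

text \<open>
  The out-degrees add up to $10$, so some vertex $y$ has an even one. If $y$ beats all other
  vertices or none, it lies on no triangle and can be $q_5$. Otherwise it beats two vertices and loses to
  two, and a triangle through $y$ uses one vertex of each kind. The pairs that must not complete a
  triangle with $q_5$ are $q_1 q_3$, $q_3 q_2$ and $q_2 q_4$; they form a path, and a path that runs through
  the two vertices beaten by $y$ first contains only one mixed pair. If some in-neighbour of $y$ beats an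
  out-neighbour of $y$, these two can be that pair. If not, the out-neighbour of $y$ that beats the other one
  loses only to $y$ and can be $q_5$.
\<close>

lemma five_vertices_arrangement:
  assumes T: "tournament_on Q E" and "card Q = 5"
  shows "\<exists>q1 q2 q3 q4 q5. Q = {q1, q2, q3, q4, q5} \<and> distinct [q1, q2, q3, q4, q5] \<and>
    \<not> triangle E q1 q3 q5 \<and> \<not> triangle E q2 q3 q5 \<and> \<not> triangle E q2 q4 q5"
proof -
  note D = tournament_onD[OF T]
  have out: "E `` {v} \<subseteq> Q - {v}" for v using D(4,5) by auto
  have "(\<Sum>v\<in>Q. outdeg E v) = 10 + card (E \<inter> Q \<times> (- Q))"
    using sum_outdeg[OF T subset_refl] assms(2) by (simp add: eval_nat_numeral)
  also have "E \<inter> Q \<times> (- Q) = {}" using D(4) by auto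
  finally have "even (\<Sum>v\<in>Q. outdeg E v)" by simp
  then have "even (card {v \<in> Q. odd (outdeg E v)})"
    using even_sum_iff[OF D(1), of "outdeg E"] by simp
  then have "{v \<in> Q. odd (outdeg E v)} \<noteq> Q" using assms(2) by (intro notI) simp
  then obtain y where y: "y \<in> Q" "even (outdeg E y)" by blast
  have c4: "card (Q - {y}) = 4" using y(1) assms(2) D(1) by simp
  define A where "A = E `` {y}"
  define B where "B = Q - {y} - A"
  have outA: "A \<subseteq> Q - {y}" unfolding A_def by (rule out)
  have fO: "finite A" unfolding A_def using D(2) by (rule finite_Image)
  have A: "(y, u) \<in> E \<longleftrightarrow> u \<in> A" for u by (simp add: A_def)
  have B: "u \<in> B \<longleftrightarrow> u \<in> Q \<and> u \<noteq> y \<and> u \<notin> A" for u by (simp add: B_def)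
  have QAB: "Q = insert y (A \<union> B)" using outA y(1) by (auto simp: B_def)
  have "card A \<le> 4" using card_mono[OF _ outA] D(1) c4 by simp
  moreover have "even (card A)" using y(2) unfolding outdeg_def A_def .
  ultimately have "card A = 0 \<or> card A = 4 \<or> card A = 2" by presburger
  then show ?thesis
  proof (elim disjE)
    assume 3: "card A = 2"
    obtain o1 o2 where O0: "A = {o1, o2}" "o1 \<noteq> o2" using 3 unfolding card_2_iff by (elim exE conjE)
    have "card B = 4 - 2"
      unfolding B_def card_Diff_subset[OF fO outA] c4 3 ..
    then have "card B = 2" by simp
    then obtain i1 i2 where I0: "B = {i1, i2}" "i1 \<noteq> i2" unfolding card_2_iff by (elim exE conjE)
    show ?thesis
    proof (cases "\<exists>i\<in>B. \<exists>u\<in>A. (i, u) \<in> E")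
      case True
      then obtain i u where iu: "i \<in> {i1, i2}" "u \<in> {o1, o2}" "(i, u) \<in> E"
        unfolding I0(1) O0(1) by blast
      obtain u' where u': "A = {u', u}" "u' \<noteq> u" using iu(2) O0 by auto
      obtain i' where i': "B = {i', i}" "i' \<noteq> i" using iu(1) I0 by auto
      have mem: "(y, u) \<in> E" "(y, u') \<in> E" "(y, i) \<notin> E" "(y, i') \<notin> E"
        using u'(1) i'(1) B[of i] B[of i'] unfolding A by simp_all
      have yn: "y \<notin> {u', i, u, i'}" "u \<notin> {i, i'}" "u' \<notin> {i, i'}"
        using mem D(5)[of y] B[of y] i'(1) by auto
      have Q: "Q = {u', i, u, i', y}" unfolding QAB u'(1) i'(1) by auto
      have "distinct [u', i, u, i', y]" using u'(2) i'(2) yn by auto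
      moreover have "\<not> triangle E u' u y" using mem D(6) unfolding triangle_def by blast
      moreover have "\<not> triangle E i u y" using mem iu(3) D(6) unfolding triangle_def by blast
      moreover have "\<not> triangle E i i' y" using mem unfolding triangle_def by blast
      ultimately show ?thesis using Q by blast
    next
      case False
      have OI: "(u, i) \<in> E" if "u \<in> A" "i \<in> B" for u i
      proof (rule D(7))
        show "u \<in> Q" "i \<in> Q" "u \<noteq> i" "(i, u) \<notin> E" using that False outA B[of i] by auto
      qed
      have oQ: "o1 \<in> Q" "o2 \<in> Q" using O0(1) outA by auto
      obtain u u' where u: "A = {u, u'}" "u \<noteq> u'" "(u, u') \<in> E"
      proof (cases "(o1, o2) \<in> E")
        case True
        then show ?thesis using that[of o1 o2] O0 by simp
      next
        case False
        then have "(o2, o1) \<in> E" using D(7)[of o2 o1] oQ O0(2) by simp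
        then show ?thesis using that[of o2 o1] O0 by (simp add: insert_commute)
      qed
      have mem: "(y, u) \<in> E" "(y, u') \<in> E" using u(1) unfolding A by simp_all
      have ni: "(y, i1) \<notin> E" "(y, i2) \<notin> E" using B[of i1] B[of i2] I0(1) unfolding A by simp_all
      have yn: "y \<notin> {i1, u', i2, u}" "u \<notin> {i1, i2}" "u' \<notin> {i1, i2}"
        using mem ni D(5)[of y] B[of y] I0(1) by auto
      have ui: "(u, i1) \<in> E" "(u, i2) \<in> E" using u(1) I0(1) by (simp_all add: OI)
      have Q: "Q = {y, i1, u', i2, u}" unfolding QAB u(1) I0(1) by auto
      have "distinct [y, i1, u', i2, u]" using u(2) I0(2) yn by auto
      moreover have "\<not> triangle E y u' u" using mem u(3) D(6) unfolding triangle_def by blast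
      moreover have "\<not> triangle E i1 u' u" using ui u(3) D(6) unfolding triangle_def by blast
      moreover have "\<not> triangle E i1 i2 u" using ui D(6) unfolding triangle_def by blast
      ultimately show ?thesis using Q by blast
    qed
  next
    assume "card A = 0"
    then have "A = {}" using fO by simp
    then have no: "\<not> triangle E a b y" for a b unfolding triangle_def A by blast
    obtain a b c d where abcd: "Q - {y} = {a, b, c, d}" "distinct [a, b, c, d]"
      using card_4E[OF _ c4] D(1) by blast
    have "Q = {a, b, c, d, y}" using abcd(1) y(1) by blast
    moreover have "distinct [a, b, c, d, y]" using abcd by auto
    ultimately show ?thesis using no by blast
  next
    assume "card A = 4"
    then have O: "A = Q - {y}" using card_subset_eq[OF _ outA] D(1) c4 by simp
    then have no: "\<not> triangle E a b y" if "a \<in> Q" "b \<in> Q" for a b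
      using that A D(5,6) unfolding triangle_def by blast
    obtain a b c d where abcd: "Q - {y} = {a, b, c, d}" "distinct [a, b, c, d]"
      using card_4E[OF _ c4] D(1) by blast
    have "Q = {a, b, c, d, y}" using abcd(1) y(1) by blast
    moreover have "distinct [a, b, c, d, y]" using abcd by auto
    ultimately show ?thesis using no by blast
  qed
qed

text \<open>
  For the subsets of $\{1, \<dots>, 5\}$ with at least three elements, the excluded ones are precisely
  those for which an element outside, one inside, one outside and one inside follow each other. For the
  others, three cut points suffice even though everything beyond $5$ is outside.
\<close>

lemma cubic_sign_pattern:
  fixes b :: "nat \<Rightarrow> bool"
  assumes "3 \<le> card {i \<in> {1..5}. b i}"
    and "{i \<in> {1..5}. b i} \<notin> {{1, 3, 5}, {2, 3, 5}, {2, 4, 5}}"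
  shows "\<exists>q\<in>cubics. (\<forall>i\<in>{1..5}. if b i then q (real i) < 0 else q (real i) > 0) \<and> (\<forall>i>5. q (real i) > 0)"
proof -
  have five: "{1..5::nat} = {1, 2, 3, 4, 5}" by auto
  have card: "card {i \<in> {1..5}. b i} = of_bool (b 1) + of_bool (b 2) + of_bool (b 3) + of_bool (b 4) + of_bool (b 5)"
  proof -
    have "card {i \<in> {1..5}. b i} = (\<Sum>i\<in>{1..5}. of_bool (b i))"
      unfolding card_eq_sum of_bool_def by (rule sum.inter_filter) simp
    then show ?thesis unfolding five by simp
  qed
  have bad: "\<not> (b 1 \<and> \<not> b 2 \<and> b 3 \<and> \<not> b 4 \<and> b 5)" "\<not> (\<not> b 1 \<and> b 2 \<and> b 3 \<and> \<not> b 4 \<and> b 5)"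
    "\<not> (\<not> b 1 \<and> b 2 \<and> \<not> b 3 \<and> b 4 \<and> b 5)"
    using assms(2) unfolding five by auto
  have cut: ?thesis
    if c: "c1 \<le> c2" "c2 \<le> c3" "c3 < 6"
      "\<forall>i\<in>{1, 2, 3, 4, 5}. if b i then real i < c1 \<or> c2 < real i \<and> real i < c3
        else c1 < real i \<and> real i < c2 \<or> c3 < real i" for c1 c2 c3
  proof (intro bexI conjI allI impI ballI)
    let ?q = "\<lambda>t::real. (t - c1) * (t - c2) * (t - c3)"
    show "?q \<in> cubics" by (rule cubics_factors)
    fix i :: nat
    {
      assume "5 < i"
      then have "real i \<ge> 6" by simp
      then show "?q (real i) > 0" using c(1-3) by (intro mult_pos_pos) linarith+
    }
    assume "i \<in> {1..5}"
    then have "if b i then real i < c1 \<or> c2 < real i \<and> real i < c3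
        else c1 < real i \<and> real i < c2 \<or> c3 < real i" using c(4) unfolding five by blast
    then show "if b i then ?q (real i) < 0 else ?q (real i) > 0"
      using c(1,2) by (auto simp: zero_less_mult_iff mult_less_0_iff split: if_splits)
  qed
  consider "b 1 \<and> b 2 \<and> b 3 \<and> b 4 \<and> b 5" | 
    "b 1 \<and> b 2 \<and> b 3 \<and> b 4 \<and> \<not> b 5" | 
    "b 1 \<and> b 2 \<and> b 3 \<and> \<not> b 4 \<and> b 5" | 
    "b 1 \<and> b 2 \<and> b 3 \<and> \<not> b 4 \<and> \<not> b 5" | 
    "b 1 \<and> b 2 \<and> \<not> b 3 \<and> b 4 \<and> b 5" | 
    "b 1 \<and> b 2 \<and> \<not> b 3 \<and> b 4 \<and> \<not> b 5" | 
    "b 1 \<and> b 2 \<and> \<not> b 3 \<and> \<not> b 4 \<and> b 5" | 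
    "b 1 \<and> \<not> b 2 \<and> b 3 \<and> b 4 \<and> b 5" | 
    "b 1 \<and> \<not> b 2 \<and> b 3 \<and> b 4 \<and> \<not> b 5" | 
    "b 1 \<and> \<not> b 2 \<and> \<not> b 3 \<and> b 4 \<and> b 5" | 
    "\<not> b 1 \<and> b 2 \<and> b 3 \<and> b 4 \<and> b 5" | 
    "\<not> b 1 \<and> b 2 \<and> b 3 \<and> b 4 \<and> \<not> b 5" | 
    "\<not> b 1 \<and> \<not> b 2 \<and> b 3 \<and> b 4 \<and> b 5"
    using assms(1) bad unfolding card
    by (cases "b 1"; cases "b 2"; cases "b 3"; cases "b 4"; cases "b 5") simp_all
  then show ?thesis
  proof cases
    case 1
    then show ?thesis by (intro cut[of "1/2" "1/2" "11/2"]) simp_all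
  next
    case 2
    then show ?thesis by (intro cut[of "1/2" "1/2" "9/2"]) simp_all
  next
    case 3
    then show ?thesis by (intro cut[of "7/2" "9/2" "11/2"]) simp_all
  next
    case 4
    then show ?thesis by (intro cut[of "1/2" "1/2" "7/2"]) simp_all
  next
    case 5
    then show ?thesis by (intro cut[of "5/2" "7/2" "11/2"]) simp_all
  next
    case 6
    then show ?thesis by (intro cut[of "5/2" "7/2" "9/2"]) simp_all
  next
    case 7
    then show ?thesis by (intro cut[of "5/2" "9/2" "11/2"]) simp_all
  next
    case 8
    then show ?thesis by (intro cut[of "3/2" "5/2" "11/2"]) simp_all
  next
    case 9
    then show ?thesis by (intro cut[of "3/2" "5/2" "9/2"]) simp_all
  next
    case 10
    then show ?thesis by (intro cut[of "3/2" "7/2" "11/2"]) simp_all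
  next
    case 11
    then show ?thesis by (intro cut[of "1/2" "3/2" "11/2"]) simp_all
  next
    case 12
    then show ?thesis by (intro cut[of "1/2" "3/2" "9/2"]) simp_all
  next
    case 13
    then show ?thesis by (intro cut[of "1/2" "5/2" "11/2"]) simp_all
  qed
qed

text \<open>
  Of two disjoint strong sets one avoids $z$, and that one is $P$ itself or a subset of $Q$. It is
  separated from all other vertices at once, so nothing has to be known about the second set.
\<close>

lemma curve_orderable_split:
  assumes T: "tournament_on V E" and V: "V = insert z (P \<union> Q)" "z \<notin> P \<union> Q" "P \<inter> Q = {}"
    and P: "card P = 3" and Q: "card Q = 5"
    and split: "\<And>C. strong E C \<Longrightarrow> C \<subseteq> V \<Longrightarrow> z \<notin> C \<Longrightarrow> C \<subseteq> P \<or> C \<subseteq> Q"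
  shows "curve_orderable V E"
proof -
  note D = tournament_onD[OF T]
  have TQ: "tournament_on Q (E \<inter> Q \<times> Q)"
    unfolding tournament_on_def
  proof (intro conjI ballI allI impI)
    show "finite Q" using D(1) V(1) by simp
    fix a b assume "a \<in> Q" "b \<in> Q" "a \<noteq> b"
    then show "((a, b) \<in> E \<inter> Q \<times> Q) = ((b, a) \<notin> E \<inter> Q \<times> Q)"
      using D(6)[of a b] D(7)[of a b] V(1) by auto
  qed (use D(5) in auto)
  obtain q1 q2 q3 q4 q5 where q: "Q = {q1, q2, q3, q4, q5}" "distinct [q1, q2, q3, q4, q5]"
    and nt: "\<not> triangle (E \<inter> Q \<times> Q) q1 q3 q5" "\<not> triangle (E \<inter> Q \<times> Q) q2 q3 q5"
      "\<not> triangle (E \<inter> Q \<times> Q) q2 q4 q5"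
    using five_vertices_arrangement[OF TQ Q] by (elim exE conjE)
  have not_strong: "\<not> strong E {a, b, c}"
    if "\<not> triangle (E \<inter> Q \<times> Q) a b c" "distinct [a, b, c]" "{a, b, c} \<subseteq> Q" for a b c
  proof
    assume "strong E {a, b, c}"
    then have "triangle E a b c" by (rule strong_triangle[OF T _ that(2)])
    then show False using that(1,3) unfolding triangle_def by blast
  qed
  have nt': "\<not> strong E {q1, q3, q5}" "\<not> strong E {q2, q3, q5}" "\<not> strong E {q2, q4, q5}"
    using q(2) by (intro not_strong nt; simp add: q(1))+
  obtain p1 p2 p3 where p: "P = {p1, p2, p3}" "distinct [p1, p2, p3]"
    using P unfolding card_3_iff by auto
  \<comment> \<open>the order along the curve\<close>
  let ?vs = "[q1, q2, q3, q4, q5, p1, p2, p3, z]"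
  have "distinct ?vs" using q p V(2,3) by auto
  then have "distinct (rev ?vs)" by (simp only: distinct_rev)
  define n :: "'a \<Rightarrow> nat" where "n v = (if v = q1 then 1 else if v = q2 then 2 else if v = q3 then 3
    else if v = q4 then 4 else if v = q5 then 5 else if v = p1 then 6 else if v = p2 then 7
    else if v = p3 then 8 else 9)" for v
  have nq: "n q1 = 1" "n q2 = 2" "n q3 = 3" "n q4 = 4" "n q5 = 5"
    and np: "n p1 = 6" "n p2 = 7" "n p3 = 8" and nz: "n z = 9"
    using \<open>distinct ?vs\<close> \<open>distinct (rev ?vs)\<close> by (simp_all add: n_def)
  have Veq: "V = set ?vs" unfolding V(1) q(1) p(1) by auto
  have "distinct (map n ?vs)" by (simp add: nq np nz)
  then have inj: "inj_on n V" unfolding Veq distinct_map by (rule conjunct2)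
  define t where "t v = real (n v)" for v
  have injt: "inj_on t V" using inj by (auto simp: inj_on_def t_def)
  have sep: "cubically_separated (t ` A) (t ` B)"
    if AB: "A \<subseteq> V" "B \<subseteq> V" "A \<inter> B = {}" "strong E B" "z \<notin> B" for A B
  proof -
    have "finite B" using AB(2) D(1) by (rule finite_subset)
    have "B \<subseteq> P \<or> B \<subseteq> Q" using split AB by blast
    then show ?thesis
    proof
      assume "B \<subseteq> P"
      then have "B = P"
        using strong_card[OF AB(4)] P p(1) by (intro card_seteq) simp_all
      then have "n v \<in> {1, 2, 3, 4, 5, 9}" if "v \<in> A" for v
        using that AB(1,3) unfolding Veq p(1) by (auto simp: nq nz)
      \<comment> \<open>$P$ occupies the positions 6, 7 and 8\<close>
      then have A: "\<forall>x\<in>t ` A. (x - 11/2) * (x - 17/2) > 0"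
        by (fastforce simp: t_def)
      have "\<forall>x\<in>t ` B. (x - 11/2) * (x - 17/2) < 0"
        unfolding \<open>B = P\<close> p(1) by (simp add: t_def np)
      with A show ?thesis
        unfolding cubically_separated_def by (intro bexI[OF _ cubics_factors(2)] conjI)
    next
      assume BQ: "B \<subseteq> Q"
      define b where "b i \<longleftrightarrow> i \<in> n ` B" for i
      have nB: "{i \<in> {1..5}. b i} = n ` B" using BQ unfolding q(1) b_def by (auto simp: nq)
      have BV: "B \<subseteq> V" "{q1, q3, q5} \<subseteq> V" "{q2, q3, q5} \<subseteq> V" "{q2, q4, q5} \<subseteq> V"
        using AB(2) unfolding V(1) q(1) by auto
      have "3 \<le> card {i \<in> {1..5}. b i}"
        unfolding nB card_image[OF inj_on_subset[OF inj BV(1)]] by (rule strong_card[OF AB(4)])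
      moreover have "n ` B \<noteq> {1, 3, 5}" "n ` B \<noteq> {2, 3, 5}" "n ` B \<noteq> {2, 4, 5}"
        using nt' AB(4) inj_on_image_eq_iff[OF inj BV(1) BV(2)] inj_on_image_eq_iff[OF inj BV(1) BV(3)]
          inj_on_image_eq_iff[OF inj BV(1) BV(4)] by (auto simp: nq)
      ultimately obtain r where r: "r \<in> cubics"
        "\<forall>i\<in>{1..5}. if b i then r (real i) < 0 else r (real i) > 0" "\<forall>i>5. r (real i) > 0"
        using cubic_sign_pattern[of b] unfolding nB by auto
      have "r (t v) < 0" if "v \<in> B" for v
      proof -
        have "b (n v)" "n v \<in> {1..5}" using that nB by (auto simp: b_def)
        then show ?thesis using r(2) by (auto simp: t_def)
      qed
      moreover have "r (t v) > 0" if "v \<in> A" for v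
      proof (cases "n v \<in> {1..5}")
        case True
        have "n v \<notin> n ` B"
          using inj_on_image_mem_iff[OF inj _ AB(2), of v] that AB(1,3) by auto
        then show ?thesis using r(2) True by (auto simp: t_def b_def)
      next
        case False
        have "n v \<ge> 1" unfolding n_def by simp
        then have "n v > 5" using False by simp
        then show ?thesis unfolding t_def by (intro r(3)[rule_format])
      qed
      ultimately show ?thesis
        unfolding cubically_separated_def using r(1) by (intro bexI[of _ r]) auto
    qed
  qed
  have "cubically_separated (t ` A) (t ` B)"
    if "A \<subseteq> V" "B \<subseteq> V" "A \<inter> B = {}" "strong E A" "strong E B" for A B
  proof (cases "z \<in> B")
    case True
    then have "z \<notin> A" using that(3) by blast
    then have "cubically_separated (t ` B) (t ` A)"
      using that by (intro sep) auto
    then show ?thesis by (rule cubically_separated_sym)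
  next
    case False
    then show ?thesis using that by (intro sep)
  qed
  then show ?thesis
    unfolding curve_orderable_def using injt by (intro exI[of _ t] conjI allI impI)
qed

text \<open>
  The removed vertex $z$ is the tail or the head of the leaving arc, whichever turns the sizes of
  the two sides of the cut into $3$ and $5$.
\<close>

lemma curve_orderable_near_cut:
  assumes T: "tournament_on V E" "card V = 9" and K: "K \<subseteq> V" "card K \<in> {3, 4, 5, 6}"
    and few: "card (E \<inter> K \<times> (- K)) \<le> 1"
  shows "curve_orderable V E"
proof -
  note D = tournament_onD[OF T(1)]
  have fin: "finite K" "finite (V - K)" using K(1) D(1) by (auto intro: finite_subset)
  have cVK: "card (V - K) = 9 - card K" using card_Diff_subset[OF fin(1) K(1)] T(2) by simp
  have "card K \<noteq> 0" "card (V - K) \<noteq> 0" unfolding cVK using K(2) by auto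
  then have ne: "K \<noteq> {}" "V - K \<noteq> {}" by (auto simp only: card.empty)
  let ?F = "E \<inter> K \<times> (- K)"
  have "finite ?F" using D(2) by simp
  have "\<exists>a\<in>K. \<exists>b\<in>V - K. ?F \<subseteq> {(a, b)}"
  proof (cases "?F = {}")
    case True
    then show ?thesis using ne by auto
  next
    case False
    then obtain a b where ab: "(a, b) \<in> ?F" by auto
    have "x = (a, b)" if "x \<in> ?F" for x
      using few that ab card_le_Suc0_iff_eq[OF \<open>finite ?F\<close>] by auto
    then have "?F \<subseteq> {(a, b)}" by blast
    moreover have "a \<in> K" "b \<in> V - K" using ab D(4) by auto
    ultimately show ?thesis by blast
  qed
  then obtain a b where a: "a \<in> K" and b: "b \<in> V - K" and F: "?F \<subseteq> {(a, b)}" by auto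
  have dich: "C \<subseteq> K - {z} \<or> C \<subseteq> V - K - {z}" if "strong E C" "C \<subseteq> V" "z \<notin> C" "z = a \<or> z = b" for C z
  proof -
    have "C \<subseteq> K \<or> C \<inter> K = {}"
      by (rule strong_in_or_out[OF that(1,3)]) (use F that(4) in auto)
    then show ?thesis using that(2,3) by auto
  qed
  have ca: "card (K - {a}) = card K - 1" and cb: "card (V - K - {b}) = 8 - card K"
    using a b fin cVK by simp_all
  have part: "V = insert z ((K - {z}) \<union> (V - K - {z}))" "V = insert z ((V - K - {z}) \<union> (K - {z}))"
      if "z = a \<or> z = b" for z using that a b K(1) by auto
  have Kb: "K - {b} = K" "V - K - {a} = V - K" using a b by auto
  consider "card K = 3" | "card K = 4" | "card K = 5" | "card K = 6" using K(2) by auto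
  then show ?thesis
  proof cases
    case 1
    show ?thesis
      by (rule curve_orderable_split[OF T(1) part(1)[of b], unfolded Kb]) (use 1 cb dich[of _ b] Kb in auto)
  next
    case 2
    show ?thesis
      by (rule curve_orderable_split[OF T(1) part(1)[of a], unfolded Kb]) (use 2 ca cVK dich[of _ a] Kb in auto)
  next
    case 3
    show ?thesis
      by (rule curve_orderable_split[OF T(1) part(2)[of b], unfolded Kb]) (use 3 cb dich[of _ b] Kb in auto)
  next
    case 4
    show ?thesis
      by (rule curve_orderable_split[OF T(1) part(2)[of a], unfolded Kb]) (use 4 ca cVK dich[of _ a] Kb in auto)
  qed
qed

section \<open>Score sequences\<close>

lemma out_degree_with_proj: "out_degree (with_proj T) v = outdeg (parcs T) v"
proof -
  have "{e \<in> parcs T. fst e = v} = Pair v ` (parcs T `` {v})" by force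
  then have "out_degree (with_proj T) v = card (Pair v ` (parcs T `` {v}))"
    unfolding out_degree_def out_arcs_def with_proj_simps by simp
  then show ?thesis
    unfolding outdeg_def by (simp add: card_image inj_on_def)
qed

definition scores :: "'a set \<Rightarrow> 'a rel \<Rightarrow> nat multiset" where
  "scores V E = image_mset (outdeg E) (mset_set V)"

lemma score_sequence_with_proj:
  "score_sequence (with_proj T) = sorted_list_of_multiset (scores (pverts T) (parcs T))"
  unfolding score_sequence_def scores_def with_proj_simps out_degree_with_proj ..

definition realizable :: "nat multiset \<Rightarrow> bool" where
  "realizable M \<longleftrightarrow> (\<exists>(V :: nat set) E. tournament_on V E \<and> scores V E = M)"

lemma size_scores: "size (scores V E) = card V"
  by (simp add: scores_def)

lemma tournament_score_sequences_iff:
  "S \<in> tournament_score_sequences n \<longleftrightarrow> sorted S \<and> length S = n \<and> realizable (mset S)"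
proof
  assume "S \<in> tournament_score_sequences n"
  then obtain T :: "nat pair_pre_digraph" where T: "tournament_on (pverts T) (parcs T)" "card (pverts T) = n"
      "S = sorted_list_of_multiset (scores (pverts T) (parcs T))"
    unfolding tournament_score_sequences_def tournament_iff score_sequence_with_proj by auto
  have "length S = size (mset S)" by simp
  also have "\<dots> = n" using T(2) by (simp add: T(3) size_scores)
  finally show "sorted S \<and> length S = n \<and> realizable (mset S)"
    using T(1) by (auto simp: T(3) realizable_def)
next
  assume S: "sorted S \<and> length S = n \<and> realizable (mset S)"
  then obtain V :: "nat set" and E where VE: "tournament_on V E" "scores V E = mset S"
    by (auto simp: realizable_def)
  let ?T = "\<lparr>pverts = V, parcs = E\<rparr>"
  have "score_sequence (with_proj ?T) = S"
    using S VE(2) by (simp add: score_sequence_with_proj sorted_sort_id)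
  moreover have "card V = n" using S VE(2) by (metis size_scores size_mset)
  ultimately show "S \<in> tournament_score_sequences n"
    unfolding tournament_score_sequences_def tournament_iff using VE(1)
    by (intro CollectI exI[of _ ?T]) simp
qed

lemma mset_set_eq_plusD:
  assumes "finite V" "mset_set V = X + Y"
  obtains A B where "V = A \<union> B" "A \<inter> B = {}" "X = mset_set A" "Y = mset_set B"
proof -
  have c: "count X x + count Y x \<le> 1" for x
    using arg_cong[OF assms(2), of "\<lambda>M. count M x"] assms(1)
    by (cases "x \<in> V") (simp_all del: One_nat_def)
  have self: "M = mset_set (set_mset M)" if M: "\<And>x. count M x \<le> 1" for M :: "'a multiset"
  proof (rule multiset_eqI)
    fix x show "count M x = count (mset_set (set_mset M)) x"
    proof (cases "x \<in># M")
      case True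
      then have "count M x \<ge> 1" by (simp add: Suc_le_eq)
      then have "count M x = 1" using M[of x] by linarith
      then show ?thesis using True by simp
    next
      case False
      then show ?thesis by (simp add: count_eq_zero_iff)
    qed
  qed
  have "X = mset_set (set_mset X)" "Y = mset_set (set_mset Y)"
    by (rule self, use c add_leD1 add_leD2 in blast)+
  moreover have "V = set_mset X \<union> set_mset Y"
    using arg_cong[OF assms(2), of set_mset] assms(1) by simp
  moreover have "set_mset X \<inter> set_mset Y = {}"
  proof -
    have "x \<notin># Y" if "x \<in># X" for x
    proof -
      have "count X x \<ge> 1" using that by (simp add: Suc_le_eq)
      then have "count Y x = 0" using c[of x] by linarith
      then show ?thesis by (simp add: count_eq_zero_iff)
    qed
    then show ?thesis by blast
  qed
  ultimately show ?thesis using that by blast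
qed

text \<open>
  A new vertex beats the vertices whose scores are collected in $M$ and loses to those whose scores are
  collected in $N$.
\<close>

lemma realizable_add_vertex:
  assumes "realizable (M + N)"
  shows "realizable (add_mset (size M) (M + image_mset Suc N))"
proof -
  obtain V :: "nat set" and E where T: "tournament_on V E" and sc: "image_mset (outdeg E) (mset_set V) = M + N"
    using assms by (auto simp: realizable_def scores_def)
  note D = tournament_onD[OF T]
  obtain X Y where XY: "mset_set V = X + Y" "M = image_mset (outdeg E) X" "N = image_mset (outdeg E) Y"
    using image_mset_eq_plusD[OF sc] by (elim exE conjE)
  obtain A B where AB: "V = A \<union> B" "A \<inter> B = {}" "X = mset_set A" "Y = mset_set B"
    by (rule mset_set_eq_plusD[OF D(1) XY(1)])
  have fin: "finite A" "finite B" using D(1) AB(1) by simp_all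
  obtain w where w: "w \<notin> V" using ex_new_if_finite[OF infinite_UNIV_nat D(1)] by (elim exE)
  have noE: "(w, v) \<notin> E" "(v, w) \<notin> E" for v using w D(3,4) by blast+
  let ?E = "E \<union> {w} \<times> A \<union> B \<times> {w}"
  have wAB: "w \<notin> A" "w \<notin> B" using w AB(1) by auto
  have T': "tournament_on (insert w V) ?E"
    unfolding tournament_on_def
  proof (intro conjI ballI allI impI)
    fix u v assume uv: "u \<in> insert w V" "v \<in> insert w V" "u \<noteq> v"
    show "((u, v) \<in> ?E) = ((v, u) \<notin> ?E)"
    proof (cases "u = w \<or> v = w")
      case True
      then show ?thesis using uv AB(1,2) wAB noE by auto
    next
      case False
      then show ?thesis using uv D(6)[of u v] D(7)[of u v] by auto
    qed
  qed (use D(1,3,4,5) AB(1) wAB in auto)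
  have "?E `` {w} = A" using wAB noE by auto
  then have ow: "outdeg ?E w = card A" by (simp add: outdeg_def)
  have oA: "outdeg ?E v = outdeg E v" if "v \<in> A" for v
  proof -
    have "?E `` {v} = E `` {v}" using that AB(2) wAB by auto
    then show ?thesis by (simp add: outdeg_def)
  qed
  have oB: "outdeg ?E v = Suc (outdeg E v)" if "v \<in> B" for v
  proof -
    have "?E `` {v} = insert w (E `` {v})" using that wAB by auto
    moreover have "finite (E `` {v})" using D(2) by (rule finite_Image)
    moreover have "w \<notin> E `` {v}" using noE by simp
    ultimately show ?thesis by (simp add: outdeg_def)
  qed
  have "scores (insert w V) ?E = add_mset (card A)
      (image_mset (outdeg ?E) (mset_set A) + image_mset (outdeg ?E) (mset_set B))"
    using w D(1) fin AB(2) by (simp add: scores_def ow AB(1) mset_set_Union)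
  also have "image_mset (outdeg ?E) (mset_set A) = M"
    unfolding XY(2) AB(3) using oA fin by (intro image_mset_cong) simp
  also have "image_mset (outdeg ?E) (mset_set B) = image_mset Suc N"
    unfolding XY(3) AB(4) multiset.map_comp o_def using oB fin by (intro image_mset_cong) simp
  finally have "scores (insert w V) ?E = add_mset (card A) (M + image_mset Suc N)" .
  moreover have "card A = size M" by (simp add: XY(2) AB(3))
  ultimately show ?thesis using T' unfolding realizable_def by auto
qed

lemma realizable_empty: "realizable {#}"
  unfolding realizable_def by (intro exI[of _ "{}"]) (simp add: tournament_on_def scores_def)

text \<open>
  The tournament analogue of the Havel--Hakimi test on a sorted list: a vertex with the smallest score
  $x$ may be assumed to beat the $x$ vertices with the smallest scores among the others. Removing it
  lowers the scores of the vertices that beat it by one.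
\<close>

function havel_hakimi :: "nat list \<Rightarrow> bool" where
  "havel_hakimi [] = True"
| "havel_hakimi (x # xs) = (x \<le> length xs \<and> list_all (\<lambda>y. 0 < y) (drop x xs) \<and>
     havel_hakimi (sort (take x xs @ map (\<lambda>y. y - 1) (drop x xs))))"
  by pat_completeness auto
termination by (relation "Wellfounded.measure length") auto

lemma havel_hakimi_realizable: "havel_hakimi S \<Longrightarrow> realizable (mset S)"
proof (induction S rule: havel_hakimi.induct)
  case 1
  then show ?case by (simp add: realizable_empty)
next
  case (2 x xs)
  let ?ys = "map (\<lambda>y. y - 1) (drop x xs)"
  have "realizable (mset (take x xs) + mset ?ys)"
    using 2 by simp
  then have "realizable (add_mset (size (mset (take x xs))) (mset (take x xs) + image_mset Suc (mset ?ys)))"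
    by (rule realizable_add_vertex)
  moreover have "size (mset (take x xs)) = x" using 2(2) by simp
  moreover have "image_mset Suc (mset ?ys) = mset (drop x xs)"
  proof -
    have "map Suc ?ys = drop x xs"
      using 2(2) by (simp add: list_all_iff map_idI)
    then show ?thesis by (metis mset_map)
  qed
  ultimately show ?case
    by (simp flip: mset_append)
qed

lemma realizable_source: "realizable M \<Longrightarrow> realizable (add_mset (size M) M)"
  using realizable_add_vertex[of M "{#}"] by simp

lemma realizable_sink: "realizable M \<Longrightarrow> realizable (add_mset 0 (image_mset Suc M))"
  using realizable_add_vertex[of "{#}" M] by simp

text \<open>
  Positions in the score sequence can be identified with vertices, so a prefix of the sequence is
  the list of out-degrees of a set of vertices.
\<close>

lemma enumerate_by_score:
  assumes "finite V" "S = sorted_list_of_multiset (scores V E)"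
  obtains vs where "distinct vs" "set vs = V" "map (outdeg E) vs = S"
proof -
  obtain us where us: "set us = V" "distinct us" using finite_distinct_list[OF assms(1)] by blast
  let ?vs = "sort_key (outdeg E) us"
  have "mset_set V = mset us" using mset_set_set[OF us(2)] us(1) by simp
  then have "S = sort (map (outdeg E) us)"
    unfolding assms(2) scores_def by (metis mset_map sorted_list_of_multiset_mset)
  moreover have "sort (map (outdeg E) us) = map (outdeg E) ?vs"
    by (rule properties_for_sort) (simp_all)
  ultimately show ?thesis using that[of ?vs] us by simp
qed

text \<open>
  The excess of a prefix sum over Landau's bound counts the arcs that leave the vertices of
  the prefix.
\<close>

lemma sum_list_take_scores:
  assumes T: "tournament_on V E" and S: "S = sorted_list_of_multiset (scores V E)" and k: "k \<le> length S"
  shows "\<exists>K\<subseteq>V. card K = k \<and> sum_list (take k S) = (\<Sum>i<k. i) + card (E \<inter> K \<times> (- K))"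
proof -
  obtain vs where vs: "distinct vs" "set vs = V" "map (outdeg E) vs = S"
    using enumerate_by_score[OF tournament_onD(1)[OF T] S] .
  let ?K = "set (take k vs)"
  have len: "length S = length vs" using vs(3) by auto
  have K: "?K \<subseteq> V" "card ?K = k"
    using vs(1,2) k len by (auto simp: distinct_card distinct_take dest: in_set_takeD)
  have "sum_list (take k S) = (\<Sum>v\<in>?K. outdeg E v)"
    unfolding vs(3)[symmetric] take_map using vs(1) by (simp add: sum_list_distinct_conv_sum_set)
  then show ?thesis using K sum_outdeg[OF T K(1)] by (intro exI[of _ ?K]) simp
qed

lemma landau_necessary:
  assumes "S \<in> tournament_score_sequences n"
  shows "k \<le> n \<Longrightarrow> (\<Sum>i<k. i) \<le> sum_list (take k S)" "sum_list S = (\<Sum>i<n. i)"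
proof -
  have S: "sorted S" "length S = n" "realizable (mset S)"
    using assms by (simp_all add: tournament_score_sequences_iff)
  then obtain V :: "nat set" and E where VE: "tournament_on V E" "scores V E = mset S"
    by (auto simp: realizable_def)
  have SE: "S = sorted_list_of_multiset (scores V E)" using S(1) VE(2) by (simp add: sorted_sort_id)
  have cV: "card V = n" using S(2) VE(2) by (metis size_scores size_mset)
  show "(\<Sum>i<k. i) \<le> sum_list (take k S)" if "k \<le> n"
  proof -
    have "k \<le> length S" using that S(2) by simp
    from sum_list_take_scores[OF VE(1) SE this] show ?thesis by auto
  qed
  obtain K where K: "K \<subseteq> V" "card K = n" "sum_list (take n S) = (\<Sum>i<n. i) + card (E \<inter> K \<times> (- K))"
    using sum_list_take_scores[OF VE(1) SE, of n] S(2) by auto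
  have "K = V" using K(1,2) cV tournament_onD(1)[OF VE(1)] by (metis card_subset_eq)
  then have "E \<inter> K \<times> (- K) = {}" using tournament_onD(4)[OF VE(1)] by auto
  then show "sum_list S = (\<Sum>i<n. i)" using K(3) S(2) by simp
qed

text \<open>
  The hypothesis depends on the score sequence alone, hence it applies to every tournament with that sequence.
\<close>

lemma linkless_near_cut:
  assumes "length S = 9" "k \<in> {3, 4, 5, 6}" "sum_list (take k S) \<le> (\<Sum>i<k. i) + 1"
  shows "linkless S"
  unfolding linkless_def tournament_iff
proof (intro allI impI, elim conjE)
  fix T :: "nat pair_pre_digraph"
  assume T: "tournament_on (pverts T) (parcs T)" and sc: "score_sequence (with_proj T) = S"
  have S: "S = sorted_list_of_multiset (scores (pverts T) (parcs T))"
    using sc by (simp add: score_sequence_with_proj)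
  have "length S = size (mset S)" by simp
  also have "\<dots> = card (pverts T)" unfolding S by (simp add: size_scores)
  finally have cV: "card (pverts T) = 9" using assms(1) by simp
  have "k \<le> length S" using assms(1,2) by auto
  then obtain K where K: "K \<subseteq> pverts T" "card K = k"
      "sum_list (take k S) = (\<Sum>i<k. i) + card (parcs T \<inter> K \<times> (- K))"
    using sum_list_take_scores[OF T S] by auto
  have "curve_orderable (pverts T) (parcs T)"
    using K assms(2,3) by (intro curve_orderable_near_cut[OF T cV K(1)]) simp_all
  then show "\<not> intrinsically_linked (with_proj T)" by (rule curve_orderable_not_linked[OF T])
qed

text \<open>
  A vertex of score $0$ is a sink and a vertex of score $|S|$ is a source in every tournament with
  the larger sequence, and deleting it leaves a tournament with sequence $S$. The function $f$ is the
  effect of the new vertex on the other scores.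
\<close>

lemma linkless_add_end_vertex:
  assumes S: "linkless S" "sorted S"
    and S': "mset S' = add_mset x (image_mset f (mset S))" and f: "inj f"
    and x: "x = 0 \<and> f = Suc \<or> x = length S \<and> f = id"
  shows "linkless S'"
  unfolding linkless_def tournament_iff
proof (intro allI impI, elim conjE)
  fix T :: "nat pair_pre_digraph"
  assume T: "tournament_on (pverts T) (parcs T)" and sc: "score_sequence (with_proj T) = S'"
  note D = tournament_onD[OF T]
  have sc': "image_mset (outdeg (parcs T)) (mset_set (pverts T)) = add_mset x (image_mset f (mset S))"
    using sc S' unfolding score_sequence_with_proj scores_def by (metis mset_sorted_list_of_multiset)
  then have "x \<in># image_mset (outdeg (parcs T)) (mset_set (pverts T))" by simp
  then obtain v where v: "v \<in> pverts T" "outdeg (parcs T) v = x" using D(1) by auto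
  let ?T' = "remove_vertex T v"
  have T': "tournament_on (pverts ?T') (parcs ?T')" by (rule tournament_on_remove_vertex[OF T])
  have "mset_set (pverts T) = add_mset v (mset_set (pverts T - {v}))"
    using v(1) D(1) by (metis mset_set.remove)
  then have rest: "image_mset (outdeg (parcs T)) (mset_set (pverts T - {v})) = image_mset f (mset S)"
    using sc' v(2) by simp
  have "size (mset_set (pverts T - {v})) = length S"
    using arg_cong[OF rest, of size] by simp
  then have card: "card (pverts T - {v}) = length S" by simp
  have sub: "parcs T `` {v} \<subseteq> pverts T - {v}" using D(4,5) by auto
  have end_vertex: "x = 0 \<and> f = Suc \<and> (\<forall>u. (v, u) \<notin> parcs T) \<or> f = id \<and> (\<forall>u. (u, v) \<notin> parcs T)"
    using x
  proof (elim disjE)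
    assume x0: "x = 0 \<and> f = Suc"
    then have "parcs T `` {v} = {}" using v(2) finite_Image[OF D(2)] by (simp add: outdeg_def)
    then show ?thesis using x0 by blast
  next
    assume xl: "x = length S \<and> f = id"
    then have "parcs T `` {v} = pverts T - {v}"
      using v(2) card D(1) by (intro card_subset_eq sub) (simp_all add: outdeg_def)
    then have "(u, v) \<notin> parcs T" for u using D(3,6)[of u v] D(5)[of v] by blast
    then show ?thesis using xl by blast
  qed
  have od: "outdeg (parcs T) u = f (outdeg (parcs ?T') u)" if u: "u \<in> pverts T - {v}" for u
    using end_vertex
  proof (elim disjE conjE)
    assume "f = Suc" "\<forall>u. (v, u) \<notin> parcs T"
    then have "(u, v) \<in> parcs T" using D(7)[of u v] u v(1) by blast
    then have "parcs T `` {u} = insert v (parcs ?T' `` {u})" using u by auto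
    moreover have "finite (parcs ?T' `` {u})" using tournament_onD(2)[OF T'] by (rule finite_Image)
    ultimately show ?thesis using \<open>f = Suc\<close> by (simp add: outdeg_def)
  next
    assume "f = id" "\<forall>u. (u, v) \<notin> parcs T"
    then have "parcs T `` {u} = parcs ?T' `` {u}" using u by auto
    then show ?thesis using \<open>f = id\<close> by (simp add: outdeg_def)
  qed
  have "image_mset (outdeg (parcs T)) (mset_set (pverts T - {v}))
      = image_mset (\<lambda>u. f (outdeg (parcs ?T') u)) (mset_set (pverts T - {v}))"
    using D(1) by (intro image_mset_cong od) simp
  then have "image_mset f (scores (pverts ?T') (parcs ?T')) = image_mset f (mset S)"
    unfolding rest scores_def multiset.map_comp o_def by (simp only: remove_vertex_simps)
  then have "scores (pverts ?T') (parcs ?T') = mset S"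
    by (rule injD[OF multiset.inj_map[OF f]])
  then have "score_sequence (with_proj ?T') = S"
    using S(2) by (simp add: score_sequence_with_proj sorted_sort_id)
  then have "\<not> intrinsically_linked (with_proj ?T')"
    using S(1) T' unfolding linkless_def tournament_iff by blast
  then show "\<not> intrinsically_linked (with_proj T)"
    using end_vertex by (intro not_linked_extend[OF T v(1)]) blast+
qed

section \<open>Enumerating score sequences\<close>

definition landau :: "nat \<Rightarrow> nat list \<Rightarrow> bool" where
  "landau n S \<longleftrightarrow> sorted S \<and> length S = n \<and> (\<forall>k\<le>n. (\<Sum>i<k. i) \<le> sum_list (take k S)) \<and>
     sum_list S = (\<Sum>i<n. i)"

lemma landau_of_tournament: "S \<in> tournament_score_sequences n \<Longrightarrow> landau n S"
  using landau_necessary[of S n] by (simp add: landau_def tournament_score_sequences_iff)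

lemma landau_less:
  assumes "landau n S" "x \<in> set S"
  shows "x < n"
proof -
  have "S \<noteq> []" using assms(2) by auto
  then obtain U y where S: "S = U @ [y]" by (metis append_butlast_last_id)
  then obtain m where n: "n = Suc m" "length U = m" using assms(1) by (auto simp: landau_def)
  have "(\<Sum>i<m. i) \<le> sum_list (take m S)" "sum_list S = (\<Sum>i<Suc m. i)"
    using assms(1) n by (simp_all add: landau_def)
  then have "y \<le> m" using n(2) by (simp add: S)
  moreover have "x \<le> y" using assms by (auto simp: S landau_def sorted_append)
  ultimately show ?thesis using n(1) by simp
qed

lemma landau_butlast:
  assumes "landau (Suc n) (S @ [n])"
  shows "landau n S"
  unfolding landau_def
proof (intro conjI allI impI)
  show "sorted S" "length S = n" "sum_list S = (\<Sum>i<n. i)"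
    using assms by (simp_all add: landau_def sorted_append)
  fix k assume "k \<le> n"
  moreover have "\<forall>j\<le>Suc n. (\<Sum>i<j. i) \<le> sum_list (take j (S @ [n]))"
    using assms unfolding landau_def by blast
  ultimately have "(\<Sum>i<k. i) \<le> sum_list (take k (S @ [n]))" by simp
  then show "(\<Sum>i<k. i) \<le> sum_list (take k S)" using \<open>k \<le> n\<close> \<open>length S = n\<close> by simp
qed

text \<open>
  Sorted continuations of a prefix of length $k$ with last entry $l$ and excess $d$ over Landau's
  bound, with $r$ entries below $N$ still to come. The second conjunct of the test discards prefixes
  for which even a constant continuation makes the total too large.
\<close>

fun score_lists :: "nat \<Rightarrow> nat \<Rightarrow> nat \<Rightarrow> nat \<Rightarrow> nat \<Rightarrow> nat list list" where
  "score_lists N 0 k l d = (if d = 0 then [[]] else [])"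
| "score_lists N (Suc r) k l d = concat (map (\<lambda>x.
     if k \<le> x + d \<and> 2 * (d + Suc r * x) \<le> Suc r * (2 * k + r)
     then map ((#) x) (score_lists N r (Suc k) x (x + d - k)) else []) [l..<N])"

lemma score_lists_complete:
  assumes "sorted S" "set S \<subseteq> {l..<N}" "length S = r"
    and "\<And>j. j \<le> r \<Longrightarrow> (\<Sum>i<j. k + i) \<le> d + sum_list (take j S)"
    and "d + sum_list S = (\<Sum>i<r. k + i)"
  shows "S \<in> set (score_lists N r k l d)"
  using assms
proof (induction r arbitrary: S k l d)
  case (Suc r)
  obtain x U where S: "S = x # U" using Suc.prems(3) by (cases S) auto
  have shift: "(\<Sum>i<Suc j. k + i) = k + (\<Sum>i<j. Suc k + i)" for j
    by (simp add: sum.lessThan_Suc_shift del: sum.lessThan_Suc)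
  have kx: "k \<le> x + d" using Suc.prems(4)[of 1] by (simp add: S)
  have "length U * x \<le> sum_list U"
    using Suc.prems(1) unfolding S by (induction U) auto
  then have "d + Suc r * x \<le> (\<Sum>i<Suc r. k + i)"
    using Suc.prems(3,5) by (simp add: S)
  then have "2 * (d + Suc r * x) \<le> 2 * (\<Sum>i<Suc r. k + i)" by (rule mult_le_mono2)
  also have "2 * (\<Sum>i<Suc r. k + i) = Suc r * (2 * k + r)"
    by (induction r) simp_all
  finally have prune: "2 * (d + Suc r * x) \<le> Suc r * (2 * k + r)" .
  have "U \<in> set (score_lists N r (Suc k) x (x + d - k))"
  proof (rule Suc.IH)
    show "sorted U" "length U = r" "set U \<subseteq> {x..<N}" using Suc.prems(1-3) by (auto simp: S)
    show "(\<Sum>i<j. Suc k + i) \<le> x + d - k + sum_list (take j U)" if "j \<le> r" for j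
      using Suc.prems(4)[of "Suc j"] that kx unfolding shift by (simp add: S)
    show "x + d - k + sum_list U = (\<Sum>i<r. Suc k + i)"
      using Suc.prems(5) kx unfolding shift by (simp add: S)
  qed
  moreover have "x \<in> set [l..<N]" using Suc.prems(2) by (simp add: S)
  ultimately show ?case
    using kx prune by (auto simp: S)
qed simp

lemma card_landau_7: "card {S. landau 7 S} \<le> 59" "finite {S. landau 7 S}"
proof -
  have sub: "{S. landau 7 S} \<subseteq> set (score_lists 7 7 0 0 0)"
  proof
    fix S assume "S \<in> {S. landau 7 S}"
    then have S: "landau 7 S" by simp
    show "S \<in> set (score_lists 7 7 0 0 0)"
      using S landau_less[OF S] by (intro score_lists_complete) (auto simp: landau_def)
  qed
  have "length (score_lists 7 7 0 0 0) = 59" by code_simp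
  then show "card {S. landau 7 S} \<le> 59"
    using card_mono[OF finite_set sub] card_length[of "score_lists 7 7 0 0 0"] by simp
  show "finite {S. landau 7 S}" using sub finite_set by (rule finite_subset)
qed

text \<open>
  The excess starts at $0$ and the entries run from $1$ to $7$, so these sequences belong to
  tournaments without sources and sinks.
\<close>

definition near_cut_scores :: "nat list list" where
  "near_cut_scores = filter (\<lambda>S. \<exists>k\<in>set [3, 4, 5, 6]. sum_list (take k S) \<le> sum_list [0..<k] + 1)
     (score_lists 8 9 0 1 0)"

abbreviation (input) linkless_scores :: "nat \<Rightarrow> nat list set" where
  "linkless_scores n \<equiv> {S \<in> tournament_score_sequences n. linkless S}"

lemma near_cut_scores:
  "58 \<le> card (set near_cut_scores)"
  "S \<in> set near_cut_scores \<Longrightarrow> S \<in> linkless_scores 9 \<and> hd S \<noteq> 0 \<and> last S \<noteq> 8"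
proof -
  have "58 \<le> length (remdups near_cut_scores)" by code_simp
  then show "58 \<le> card (set near_cut_scores)" by (simp add: length_remdups_card_conv)
  have all: "list_all (\<lambda>S. length S = 9 \<and> sorted S \<and> havel_hakimi S \<and> hd S \<noteq> 0 \<and> last S \<noteq> 8) near_cut_scores"
    by code_simp
  assume S: "S \<in> set near_cut_scores"
  then have P: "length S = 9" "sorted S" "havel_hakimi S" "hd S \<noteq> 0" "last S \<noteq> 8"
    using all by (simp_all add: list_all_iff)
  have "\<exists>k\<in>{3, 4, 5, 6}. sum_list (take k S) \<le> sum_list [0..<k] + 1"
    using S unfolding near_cut_scores_def by (simp only: set_filter list.set mem_Collect_eq)
  then obtain k where k: "k \<in> {3, 4, 5, 6}" "sum_list (take k S) \<le> sum_list [0..<k] + 1"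
    by (elim bexE)
  have "sum_list [0..<k] = (\<Sum>i<k. i)"
    by (simp add: interv_sum_list_conv_sum_set_nat atLeast0LessThan)
  then have "sum_list (take k S) \<le> (\<Sum>i<k. i) + 1" using k(2) by simp
  then have "linkless S" by (rule linkless_near_cut[OF P(1) k(1)])
  then show "S \<in> linkless_scores 9 \<and> hd S \<noteq> 0 \<and> last S \<noteq> 8"
    using P havel_hakimi_realizable[OF P(3)] by (simp add: tournament_score_sequences_iff)
qed

section \<open>Counting linkless score sequences\<close>

lemma finite_linkless_scores: "finite (linkless_scores n)"
proof (rule finite_subset)
  show "linkless_scores n \<subseteq> {S. set S \<subseteq> {..<n} \<and> length S = n}"
    using landau_less[OF landau_of_tournament] by (auto simp: tournament_score_sequences_iff)
  show "finite {S. set S \<subseteq> {..<n} \<and> length S = n}" by (rule finite_lists_length_eq) simp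
qed

lemma linkless_add_source:
  assumes "S \<in> linkless_scores n"
  shows "S @ [n] \<in> linkless_scores (Suc n)"
proof -
  have S: "sorted S" "length S = n" "realizable (mset S)" "linkless S"
    using assms by (simp_all add: tournament_score_sequences_iff)
  have "x \<le> n" if "x \<in> set S" for x
    using landau_less[OF landau_of_tournament, of S n x] assms that by simp
  then have "sorted (S @ [n])" using S(1) by (simp add: sorted_append)
  moreover have "realizable (mset (S @ [n]))"
    using realizable_source[OF S(3)] S(2) by simp
  moreover have "linkless (S @ [n])"
    by (rule linkless_add_end_vertex[OF S(4,1), of _ n id]) (use S(2) in simp_all)
  ultimately show ?thesis using S(2) by (simp add: tournament_score_sequences_iff)
qed

lemma linkless_add_sink:
  assumes "S \<in> linkless_scores n"
  shows "0 # map Suc S \<in> linkless_scores (Suc n)"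
proof -
  have S: "sorted S" "length S = n" "realizable (mset S)" "linkless S"
    using assms by (simp_all add: tournament_score_sequences_iff)
  have "sorted (map Suc S)" unfolding sorted_map by (rule sorted_wrt_mono_rel[OF _ S(1)]) simp
  then have "sorted (0 # map Suc S)" by simp
  moreover have "realizable (mset (0 # map Suc S))"
    using realizable_sink[OF S(3)] by simp
  moreover have "linkless (0 # map Suc S)"
    by (rule linkless_add_end_vertex[OF S(4,1), of _ 0 Suc]) simp_all
  ultimately show ?thesis using S(2) by (simp add: tournament_score_sequences_iff)
qed

text \<open>
  The set $N(n)$ of the introduction.
\<close>

definition sourceless :: "nat \<Rightarrow> nat list set" where
  "sourceless n = {S \<in> linkless_scores n. last S \<noteq> n - 1}"

lemma finite_sourceless: "finite (sourceless n)"
  by (rule finite_subset[OF _ finite_linkless_scores[of n]]) (auto simp: sourceless_def)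

lemma add_sink_sourceless:
  assumes "0 < n"
  shows "(\<lambda>S. 0 # map Suc S) ` sourceless n \<subseteq> sourceless (Suc n)"
proof
  fix S' assume "S' \<in> (\<lambda>S. 0 # map Suc S) ` sourceless n"
  then obtain S where S: "S' = 0 # map Suc S" "S \<in> linkless_scores n" "last S \<noteq> n - 1"
    by (auto simp: sourceless_def)
  have "S \<noteq> []" using S(2) assms by (auto simp: tournament_score_sequences_iff)
  then have "last S' = Suc (last S)" by (simp add: S(1) last_map)
  then show "S' \<in> sourceless (Suc n)"
    using linkless_add_sink[OF S(2)] S(1,3) assms by (auto simp: sourceless_def)
qed

lemma card_add_sink: "card ((\<lambda>S. 0 # map Suc S) ` X) = card X"
  by (intro card_image inj_onI) (simp add: inj_map_eq_map)

lemma card_sourceless_mono: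
  assumes "0 < n"
  shows "card (sourceless n) \<le> card (sourceless (Suc n))"
  using card_mono[OF finite_sourceless add_sink_sourceless[OF assms]] by (simp only: card_add_sink)

lemma card_linkless_Suc:
  "card (linkless_scores n) + card (sourceless (Suc n)) \<le> card (linkless_scores (Suc n))"
proof -
  let ?A = "(\<lambda>S. S @ [n]) ` linkless_scores n"
  have "?A \<union> sourceless (Suc n) \<subseteq> linkless_scores (Suc n)"
    using linkless_add_source unfolding sourceless_def by blast
  then have "card (?A \<union> sourceless (Suc n)) \<le> card (linkless_scores (Suc n))"
    by (rule card_mono[OF finite_linkless_scores])
  moreover have "?A \<inter> sourceless (Suc n) = {}" by (auto simp: sourceless_def)
  then have "card (?A \<union> sourceless (Suc n)) = card ?A + card (sourceless (Suc n))"
    by (intro card_Un_disjoint finite_imageI finite_linkless_scores finite_sourceless)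
  moreover have "card ?A = card (linkless_scores n)"
    by (intro card_image inj_onI) simp
  ultimately show ?thesis by simp
qed

text \<open>
  The sequences from \<open>near_cut_scores\<close> do not begin with $0$, so they are different from those obtained
  by adding a sink.
\<close>

lemma card_sourceless_9: "card (linkless_scores 8) \<le> card (sourceless 9) + 1"
proof -
  let ?F = "{S \<in> linkless_scores 8. last S = 7}"
  have "?F \<subseteq> (\<lambda>S. S @ [7]) ` {S. landau 7 S}"
  proof
    fix S assume "S \<in> ?F"
    then have S: "landau 8 S" "last S = 7" using landau_of_tournament by auto
    have "S \<noteq> []" using S(1) by (auto simp: landau_def)
    then have "S = butlast S @ [7]" using S(2) by (metis append_butlast_last_id)
    moreover have "landau 7 (butlast S)"
      using landau_butlast[of 7 "butlast S"] S(1) \<open>S = butlast S @ [7]\<close> by simp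
    ultimately show "S \<in> (\<lambda>S. S @ [7]) ` {S. landau 7 S}" by blast
  qed
  then have "card ?F \<le> card {S. landau 7 S}"
    using card_landau_7(2) by (rule surj_card_le[rotated])
  then have F: "card ?F \<le> 59" using card_landau_7(1) by simp
  have "linkless_scores 8 \<subseteq> sourceless 8 \<union> ?F" by (auto simp: sourceless_def)
  then have "card (linkless_scores 8) \<le> card (sourceless 8 \<union> ?F)"
    by (rule card_mono[rotated]) (intro finite_UnI finite_sourceless finite_subset[OF _ finite_linkless_scores[of 8]], blast)
  then have "card (linkless_scores 8) \<le> card (sourceless 8) + card ?F"
    by (rule order_trans[OF _ card_Un_le])
  moreover have "card (sourceless 8) + card (set near_cut_scores) \<le> card (sourceless 9)"
  proof -
    let ?B = "(\<lambda>S. 0 # map Suc S) ` sourceless 8"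
    have "?B \<union> set near_cut_scores \<subseteq> sourceless 9"
      using add_sink_sourceless[of 8] near_cut_scores(2) by (auto simp: sourceless_def)
    then have "card (?B \<union> set near_cut_scores) \<le> card (sourceless 9)"
      by (rule card_mono[OF finite_sourceless])
    moreover have "?B \<inter> set near_cut_scores = {}" using near_cut_scores(2) by fastforce
    then have "card (?B \<union> set near_cut_scores) = card ?B + card (set near_cut_scores)"
      by (intro card_Un_disjoint finite_imageI finite_set finite_sourceless)
    ultimately show ?thesis by (simp add: card_add_sink)
  qed
  ultimately show ?thesis using F near_cut_scores(1) by linarith
qed

theorem proposition5p1:
  fixes k n :: nat
  assumes "k = card {S \<in> tournament_score_sequences 8. linkless S}"
    and "n \<ge> 8"
  shows "int (card {S \<in> tournament_score_sequences n. linkless S}) \<ge> (int n - 7) * (int k - 1) + 1"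
  using assms(2)
proof (induction n rule: dec_induct)
  case base
  then show ?case using assms(1) by simp
next
  case (step n)
  have "card (sourceless 9) \<le> card (sourceless (Suc n))"
    using step(1)
  proof (induction n rule: dec_induct)
    case (step m)
    then show ?case using card_sourceless_mono[of "Suc m"] by simp
  qed simp
  then have "int k - 1 \<le> int (card (sourceless (Suc n)))"
    using card_sourceless_9 assms(1) by linarith
  moreover have "int (card (linkless_scores n)) + int (card (sourceless (Suc n))) \<le> int (card (linkless_scores (Suc n)))"
    using card_linkless_Suc[of n] by linarith
  moreover have "(int (Suc n) - 7) * (int k - 1) = (int n - 7) * (int k - 1) + (int k - 1)"
    by (simp add: algebra_simps)
  ultimately show ?case using step.IH by linarith
qed

end
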